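(* Let $\mathbf{y}_1,\ldots,\mathbf{y}_n$ be a random sample from a $d$-dimensional elliptical distribution with location $\boldsymbol{\mu}\in\mathbb{R}^d$, unknown positive-definite scatter matrix $\Sigma$ and density generator $g$. Let $\Sigma_0$ be a specified positive-definite $d\times d$ matrix, and consider testing $H_0:\Sigma=\Sigma_0$ against $H_1:\Sigma\neq\Sigma_0$. Fix $\alpha\in(0,1)$, let $\hat S_n=\frac1n\sum_{i=1}^n(\mathbf y_i-\bar{\mathbf y})(\mathbf y_i-\bar{\mathbf y})'$ be the sample variance-covariance matrix, where $\bar{\mathbf y}=\frac1n\sum_{i=1}^n\mathbf y_i$, and set $$T_n^2=\big\|\sqrt n\,\mathrm{vec}(\hat S_n-\Sigma_0)\big\|^2 .$$ Let $c^\star_\alpha$ be the $(1-\alpha)$-th quantile of the distribution of $\sum_{i=1}^{d^2}\lambda_i^\star Z_i^{\star2}$, where $Z_1^\star,\ldots,Z_{d^2}^\star$ are i.i.d. $N(0,1)$ random variables and $\lambda_1^\star,\ldots,\lambda_{d^2}^\star$ are the eigenvalues of $$(1+\kappa)(I_{d^2}+K_{d,d})(\Sigma_0\otimes\Sigma_0)+\kappa\,\mathrm{vec}(\Sigma_0)\,\mathrm{vec}(\Sigma_0)' .$$ Then the test that rejects $H_0$ when $T_n^2>c^\star_\alpha$ has asymptotic size $\alpha$, i.e. $\lim_{n\to\infty}P_{H_0}[T_n^2>c^\star_\alpha]=\alpha$. Further, this test is consistent: when $H_1$ is true, i.e. $\Sigma=\Sigma_1$ for some $\Sigma_1\neq\Sigma_0$,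 $\lim_{n\to\infty}P_{H_1}[T_n^2>c^\star_\alpha]=1$.
   Context: Elliptical distribution: $\mathbf{Y}$ has density $f_{\mathbf Y}(\mathbf y)=k|\Sigma|^{-1/2}g\big((\mathbf y-\boldsymbol\mu)'\Sigma^{-1}(\mathbf y-\boldsymbol\mu)\big)$ on $\mathbb{R}^d$, where $g$ is the density generator with $\int_0^\infty x^{d/2-1}g(x)\,dx<\infty$ and $k=\frac{\Gamma(d/2)}{\pi^{d/2}}\big[\int_0^\infty x^{d/2-1}g(x)\,dx\big]^{-1}$ is the normalizing constant. $\mathrm{vec}$ stacks the columns of a matrix; $\|\cdot\|$ is the Euclidean norm; $\otimes$ is the Kronecker product. $K_{d,d}=\sum_{i=1}^d\sum_{j=1}^d J_{ij}\otimes J_{ij}'$ is the $d^2\times d^2$ commutation matrix, where $J_{ij}$ is the $d\times d$ matrix with one in position $(i,j)$ and zeros elsewhere. $\kappa$ is the kurtosis parameter of $\mathbf Y$, defined by $3\kappa=E\{(Y_i-\mu_i)^4\}/\sigma_{ii}^2-3$, where $Y_i$, $\mu_i$ are the $i$-th components of $\mathbf Y$, $\boldsymbol\mu$, and $\Sigma=((\sigma_{ij}))_{i,j=1,\ldots,d}$.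
   Formalization: The density generator is assumed scaled so that the scatter matrix Σ equals the covariance matrix of Y (otherwise the size claim fails, e.g. g(x)=exp(-x), d=1), and fourth moments are assumed finite so that κ is defined. *)

theory Defs
  imports "HOL-Probability.Probability" "HOL-Computational_Algebra.Polynomial"
begin

section \<open>Matrices\<close>

definition pos_def :: "real^'n^'n \<Rightarrow> bool" where
  "pos_def A \<longleftrightarrow> transpose A = A \<and> (\<forall>x. x \<noteq> 0 \<longrightarrow> 0 < x \<bullet> (A *v x))"

definition outer :: "real^'m \<Rightarrow> real^'n \<Rightarrow> real^'n^'m" where
  "outer u v = (\<chi> i j. u $ i * v $ j)"

text \<open>
  Vectors of length \<open>d\<^sup>2\<close> are indexed by pairs. In \<open>vec_mat\<close> the pair \<open>(j, i)\<close> stands for the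
  \<open>i\<close>-th entry of the \<open>j\<close>-th column, and in \<open>kron\<close> the first component of a pair is the block
  index; under the lexicographic order of pairs both are the usual conventions.
\<close>

definition vec_mat :: "real^'n^'m \<Rightarrow> real^('n \<times> 'm)" where
  "vec_mat A = (\<chi> p. A $ snd p $ fst p)"

definition kron :: "real^'n^'m \<Rightarrow> real^'q^'p \<Rightarrow> real^('n \<times> 'q)^('m \<times> 'p)" where
  "kron A B = (\<chi> r c. A $ fst r $ fst c * B $ snd r $ snd c)"

definition unit_mat :: "'m \<Rightarrow> 'n \<Rightarrow> real^'n^'m" where
  "unit_mat i j = (\<chi> a b. if a = i \<and> b = j then 1 else 0)"

definition commutation_mat :: "real^('d::finite \<times> 'd)^('d \<times> 'd)" where
  "commutation_mat =
     (\<Sum>i\<in>UNIV. \<Sum>j\<in>UNIV. kron (unit_mat i j :: real^'d^'d) (transpose (unit_mat i j)))"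

lemma sum_UNIV_pair:
  "(\<Sum>p\<in>UNIV. f p) = (\<Sum>a\<in>UNIV. \<Sum>b\<in>UNIV. f (a :: 'a::finite, b :: 'b::finite))"
  by (simp add: sum.cartesian_product)

lemma commutation_mat_vec_mat:
  fixes A :: "real^'d^'d"
  shows "commutation_mat *v vec_mat A = vec_mat (transpose A)"
proof -
  have *: "commutation_mat $ (a, b) $ (c, e) = (if a = e \<and> b = c then 1 else (0::real))"
    for a b c e :: 'd
  proof -
    have "commutation_mat $ (a, b) $ (c, e) =
        (\<Sum>i\<in>UNIV. \<Sum>j\<in>UNIV. if i = a then if j = c then if a = e \<and> b = c then 1 else 0 else 0 else (0::real))"
      unfolding commutation_mat_def
      by (auto simp: kron_def unit_mat_def transpose_def intro!: sum.cong)
    also have "\<dots> = (\<Sum>i\<in>UNIV. if i = a then (\<Sum>j\<in>UNIV. if j = c then if a = e \<and> b = c then 1 else 0 else 0) else (0::real))"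
      by (intro sum.cong) auto
    also have "\<dots> = (if a = e \<and> b = c then 1 else 0)"
      by simp
    finally show ?thesis .
  qed
  have "(commutation_mat *v vec_mat A) $ (a, b) = vec_mat (transpose A) $ (a, b)" for a b
  proof -
    have "(commutation_mat *v vec_mat A) $ (a, b) =
        (\<Sum>c\<in>UNIV. \<Sum>e\<in>UNIV. if e = a then if c = b then A $ a $ b else 0 else 0)"
      unfolding matrix_vector_mult_def vec_lambda_beta sum_UNIV_pair
      by (intro sum.cong refl) (simp add: * vec_mat_def)
    then show ?thesis
      by (simp add: vec_mat_def transpose_def)
  qed
  then show ?thesis
    by (auto simp: vec_eq_iff)
qed

lemma kron_vec_mat:
  fixes A B X :: "real^'d^'d"
  shows "kron B A *v vec_mat X = vec_mat (A ** X ** transpose B)"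
proof -
  have "(kron B A *v vec_mat X) $ (a, b) = vec_mat (A ** X ** transpose B) $ (a, b)" for a b
    by (simp add: matrix_vector_mult_def sum_UNIV_pair kron_def vec_mat_def matrix_matrix_mult_def transpose_def sum_distrib_left
        sum_distrib_right mult_ac)
  then show ?thesis
    by (auto simp: vec_eq_iff)
qed

definition charpoly :: "real^'n^'n \<Rightarrow> real poly" where
  "charpoly A = det (\<chi> i j. (if i = j then [:0, 1:] else 0) - [:A $ i $ j:])"

text \<open>\<open>lam 1, \<dots>, lam m\<close> are the eigenvalues of \<open>A\<close>, repeated according to multiplicity.\<close>

definition eigenvalue_list :: "real^'n^'n \<Rightarrow> nat \<Rightarrow> (nat \<Rightarrow> real) \<Rightarrow> bool" where
  "eigenvalue_list A m lam \<longleftrightarrow> charpoly A = (\<Prod>k\<in>{1..m}. [:- lam k, 1:])"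


section \<open>Elliptical distributions\<close>

text \<open>
  Positivity of the integral is implicit in the use of its reciprocal as a normalizing constant.
\<close>

definition density_generator :: "nat \<Rightarrow> (real \<Rightarrow> real) \<Rightarrow> bool" where
  "density_generator d g \<longleftrightarrow>
     (\<forall>x\<ge>0. 0 \<le> g x) \<and>
     set_integrable lborel {0<..} (\<lambda>x. x powr (real d / 2 - 1) * g x) \<and>
     0 < (LBINT x:{0<..}. x powr (real d / 2 - 1) * g x)"

definition normalizing_const :: "nat \<Rightarrow> (real \<Rightarrow> real) \<Rightarrow> real" where
  "normalizing_const d g =
     Gamma (real d / 2) / pi powr (real d / 2) *
       inverse (LBINT x:{0<..}. x powr (real d / 2 - 1) * g x)"

definition elliptical_density ::
    "real^'d \<Rightarrow> real^'d^'d \<Rightarrow> (real \<Rightarrow> real) \<Rightarrow> real^'d \<Rightarrow> real" where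
  "elliptical_density \<mu> S g y =
     normalizing_const CARD('d) g * det S powr (- 1 / 2) *
       g ((y - \<mu>) \<bullet> (matrix_inv S *v (y - \<mu>)))"

definition elliptical_sample ::
    "'a measure \<Rightarrow> (nat \<Rightarrow> 'a \<Rightarrow> real^'d) \<Rightarrow> real^'d \<Rightarrow> real^'d^'d \<Rightarrow> (real \<Rightarrow> real) \<Rightarrow> bool" where
  "elliptical_sample M Y \<mu> S g \<longleftrightarrow>
     prob_space.indep_vars M (\<lambda>_. borel) Y {1..} \<and>
     (\<forall>i\<ge>1. distributed M lborel (Y i) (\<lambda>y. ennreal (elliptical_density \<mu> S g y)))"

definition covariance_mat :: "'a measure \<Rightarrow> ('a \<Rightarrow> real^'d) \<Rightarrow> real^'d \<Rightarrow> real^'d^'d" where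
  "covariance_mat M X \<mu> =
     (\<chi> i j. integral\<^sup>L M (\<lambda>\<omega>. (X \<omega> $ i - \<mu> $ i) * (X \<omega> $ j - \<mu> $ j)))"

text \<open>
  The solution \<open>\<kappa>\<close> of \<open>3 \<kappa> = E ((X\<^sub>i - \<mu>\<^sub>i)^4) / \<sigma>\<^sub>i\<^sub>i\<^sup>2 - 3\<close>, read off from component \<open>i\<close>. For
  elliptical \<open>X\<close> it does not depend on \<open>i\<close>.
\<close>

definition kurtosis_param :: "'a measure \<Rightarrow> ('a \<Rightarrow> real^'d) \<Rightarrow> real^'d \<Rightarrow> real^'d^'d \<Rightarrow> 'd \<Rightarrow> real" where
  "kurtosis_param M X \<mu> S i =
     (integral\<^sup>L M (\<lambda>\<omega>. (X \<omega> $ i - \<mu> $ i) ^ 4) / (S $ i $ i)\<^sup>2 - 3) / 3"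


section \<open>The test\<close>

definition sample_mean :: "nat \<Rightarrow> (nat \<Rightarrow> real^'d) \<Rightarrow> real^'d" where
  "sample_mean n y = (1 / real n) *\<^sub>R (\<Sum>i\<in>{1..n}. y i)"

definition sample_cov :: "nat \<Rightarrow> (nat \<Rightarrow> real^'d) \<Rightarrow> real^'d^'d" where
  "sample_cov n y =
     (1 / real n) *\<^sub>R (\<Sum>i\<in>{1..n}. outer (y i - sample_mean n y) (y i - sample_mean n y))"

definition T_sq :: "real^'d^'d \<Rightarrow> nat \<Rightarrow> (nat \<Rightarrow> real^'d) \<Rightarrow> real" where
  "T_sq S0 n y = (norm (sqrt (real n) *\<^sub>R vec_mat (sample_cov n y - S0)))\<^sup>2"

definition limit_mat :: "real \<Rightarrow> real^'d^'d \<Rightarrow> real^('d \<times> 'd)^('d \<times> 'd)" where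
  "limit_mat \<kappa> S0 =
     (1 + \<kappa>) *\<^sub>R ((mat 1 + commutation_mat) ** kron S0 S0)
       + \<kappa> *\<^sub>R outer (vec_mat S0) (vec_mat S0)"

definition weighted_chisq :: "nat \<Rightarrow> (nat \<Rightarrow> real) \<Rightarrow> real measure" where
  "weighted_chisq m lam =
     distr (Pi\<^sub>M {1..m} (\<lambda>_. density lborel (\<lambda>x. ennreal (std_normal_density x)))) borel
       (\<lambda>z. \<Sum>k\<in>{1..m}. lam k * (z k)\<^sup>2)"

definition quantile :: "real measure \<Rightarrow> real \<Rightarrow> real" where
  "quantile D p = Inf {x. p \<le> cdf D x}"

end

theory Submission
  imports Defs
begin

text \<open>
  Let \<open>X\<^sub>k = Y\<^sub>k - \<mu>\<close>, \<open>W\<^sub>k = vec (X\<^sub>k X\<^sub>k' - \<Sigma>)\<close> and \<open>U\<^sub>n = (W\<^sub>1 + \<dots> + W\<^sub>n) / \<surd>n\<close>. Under the null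
  hypothesis the test statistic is the squared norm of \<open>U\<^sub>n\<close> up to a remainder whose expected norm is
  \<open>O(1 / \<surd>n)\<close>, so it suffices to find the limit of the Laplace transforms \<open>E exp (- s \<bar>U\<^sub>n\<bar>\<^sup>2)\<close> at integers
  \<open>s\<close>. For an independent standard Gaussian vector \<open>G\<close>, with coordinates taken in an orthonormal
  eigenbasis of the covariance matrix \<open>V\<close> of the \<open>W\<^sub>k\<close>, one has \<open>exp (- s \<bar>x\<bar>\<^sup>2) = E exp (\<i> \<surd>(2 s) G \<bullet> x)\<close>.
  Conditioning on \<open>G\<close> reduces the limit to the one-dimensional central limit theorem, and it is
  \<open>E exp (- s \<Sum> d\<^sub>i G\<^sub>i\<^sup>2)\<close>, where the \<open>d\<^sub>i\<close> are the eigenvalues of \<open>V\<close>.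

  That \<open>V\<close> is the matrix of the theorem follows from symmetry: if \<open>u' \<Sigma> u = v' \<Sigma> v\<close>, some reflection that
  preserves \<open>x' \<Sigma>\<inverse> x\<close>, hence the density, exchanges the functionals \<open>u\<close> and \<open>v\<close>. Therefore
  \<open>E (u \<bullet> X)\<^sup>4\<close> is a multiple of \<open>(u' \<Sigma> u)\<^sup>2\<close>, and polarization yields all fourth moments.
  Consistency is a Chebyshev estimate.
\<close>

section \<open>Convergence of Laplace transforms on the half-line\<close>

lemma (in prob_space) integrable_power_mult_power_unit_interval:
  fixes X :: "'a \<Rightarrow> real"
  assumes "X \<in> borel_measurable M" and X01: "AE x in M. X x \<in> {0..1}"
  shows "integrable M (\<lambda>x. X x ^ i * (1 - X x) ^ j)"
proof (rule integrable_const_bound[of _ 1])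
  have "\<bar>x ^ i * (1 - x) ^ j\<bar> \<le> 1" if "x \<in> {0..1}" for x :: real
    using that by (auto simp: abs_mult power_abs intro!: mult_le_one power_le_one)
  then show "AE x in M. norm (X x ^ i * (1 - X x) ^ j) \<le> 1"
    unfolding real_norm_def by (rule eventually_mono[OF X01])
qed (use assms(1) in measurable)

text \<open>The identity \<open>x^a (1-x)^(b+1) = x^a (1-x)^b - x^(a+1) (1-x)^b\<close> lowers the
  exponent of \<open>1 - x\<close> until only plain moments remain. It raises the other exponent, so
  \<open>a\<close> stays arbitrary in the induction.\<close>

lemma (in prob_space) Bernstein_moments_tendsto:
  fixes N :: "nat \<Rightarrow> 'b measure" and X :: "nat \<Rightarrow> 'b \<Rightarrow> real" and Y :: "'a \<Rightarrow> real"
  assumes N: "\<And>n. prob_space (N n)"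
    and X[measurable]: "\<And>n. X n \<in> borel_measurable (N n)" and Y[measurable]: "Y \<in> borel_measurable M"
    and X01: "\<And>n. AE x in N n. X n x \<in> {0..1}" and Y01: "AE x in M. Y x \<in> {0..1}"
    and moments: "\<And>j. (\<lambda>n. \<integral>x. X n x ^ j \<partial>N n) \<longlonglongrightarrow> (\<integral>x. Y x ^ j \<partial>M)"
  shows "(\<lambda>n. \<integral>x. X n x ^ a * (1 - X n x) ^ b \<partial>N n) \<longlonglongrightarrow> (\<integral>x. Y x ^ a * (1 - Y x) ^ b \<partial>M)"
proof (induction b arbitrary: a)
  case 0
  then show ?case using moments by simp
next
  case (Suc b)
  have "integrable (N n) (\<lambda>x. X n x ^ i * (1 - X n x) ^ j)" for n i j
    by (rule prob_space.integrable_power_mult_power_unit_interval[OF N X X01])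
  moreover have "integrable M (\<lambda>x. Y x ^ i * (1 - Y x) ^ j)" for i j
    by (rule integrable_power_mult_power_unit_interval[OF Y Y01])
  moreover have "x ^ a * (1 - x) ^ Suc b = x ^ a * (1 - x) ^ b - x ^ Suc a * (1 - x) ^ b" for x :: real
    by (simp add: algebra_simps)
  ultimately show ?case
    using tendsto_diff[OF Suc[of a] Suc[of "Suc a"]] by (simp only: Bochner_Integration.integral_diff)
qed

text \<open>Hausdorff's moment argument: a Bernstein polynomial approximates \<open>f\<close>
  uniformly on the unit interval, its integrals converge because the moments do, and the
  approximation error does not depend on \<open>n\<close>. Continuity on the whole line also makes
  \<open>f\<close> Borel measurable.\<close>

lemma (in prob_space) moments_tendsto_imp_integral_tendsto:
  fixes N :: "nat \<Rightarrow> 'b measure" and X :: "nat \<Rightarrow> 'b \<Rightarrow> real" and Y :: "'a \<Rightarrow> real" and f :: "real \<Rightarrow> real"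
  assumes N: "\<And>n. prob_space (N n)"
    and X[measurable]: "\<And>n. X n \<in> borel_measurable (N n)" and Y[measurable]: "Y \<in> borel_measurable M"
    and X01: "\<And>n. AE x in N n. X n x \<in> {0..1}" and Y01: "AE x in M. Y x \<in> {0..1}"
    and moments: "\<And>j. (\<lambda>n. \<integral>x. X n x ^ j \<partial>N n) \<longlonglongrightarrow> (\<integral>x. Y x ^ j \<partial>M)"
    and f: "continuous_on UNIV f"
  shows "(\<lambda>n. \<integral>x. f (X n x) \<partial>N n) \<longlonglongrightarrow> (\<integral>x. f (Y x) \<partial>M)"
proof (rule LIMSEQ_I)
  fix e :: real assume "0 < e"
  \<comment> \<open>Three errors of at most \<open>e / 4\<close>, two from replacing
    \<open>f\<close> by a polynomial and one from convergence, add up to less than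
    \<open>e\<close>.\<close>
  define e' where "e' = e / 4"
  have "e' > 0" using \<open>0 < e\<close> by (simp add: e'_def)
  have f01: "continuous_on {0..1} f" using f continuous_on_subset by blast
  have [measurable]: "f \<in> borel_measurable borel" using f by (rule borel_measurable_continuous_onI)
  obtain K where K: "\<And>k x. k \<ge> K \<Longrightarrow> x \<in> {0..1} \<Longrightarrow> \<bar>f x - (\<Sum>i\<le>k. f (i / k) * Bernstein k i x)\<bar> < e'"
    using Bernstein_Weierstrass[OF f01 \<open>e' > 0\<close>] by blast
  define p where "p x = (\<Sum>i\<le>K. f (i / K) * Bernstein K i x)" for x
  have p: "\<bar>f x - p x\<bar> \<le> e'" if "x \<in> {0..1}" for x
    using K[of K x] that by (simp add: p_def less_imp_le)
  obtain C where C: "\<And>x. x \<in> {0..1} \<Longrightarrow> \<bar>f x\<bar> \<le> C"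
    using compact_imp_bounded[OF compact_continuous_image[OF f01 compact_Icc]]
    unfolding bounded_iff by (metis imageI real_norm_def)
  have intXB: "integrable (N n) (\<lambda>x. X n x ^ i * (1 - X n x) ^ j)" for n i j
    by (rule prob_space.integrable_power_mult_power_unit_interval[OF N X X01])
  have intYB: "integrable M (\<lambda>x. Y x ^ i * (1 - Y x) ^ j)" for i j
    by (rule integrable_power_mult_power_unit_interval[OF Y Y01])
  have intXp: "integrable (N n) (\<lambda>x. p (X n x))" for n
    unfolding p_def Bernstein_def mult.assoc
    by (intro Bochner_Integration.integrable_sum integrable_mult_right intXB)
  have intYp: "integrable M (\<lambda>x. p (Y x))"
    unfolding p_def Bernstein_def mult.assoc
    by (intro Bochner_Integration.integrable_sum integrable_mult_right intYB)
  have intXf: "integrable (N n) (\<lambda>x. f (X n x))" for n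
    by (rule finite_measure.integrable_const_bound[OF prob_space.finite_measure[OF N]])
      (auto intro!: eventually_mono[OF X01] C simp del: atLeastAtMost_iff)
  have intYf: "integrable M (\<lambda>x. f (Y x))"
    by (rule integrable_const_bound) (auto intro!: eventually_mono[OF Y01] C simp del: atLeastAtMost_iff)
  have "(\<lambda>n. \<integral>x. p (X n x) \<partial>N n) \<longlonglongrightarrow> (\<integral>x. p (Y x) \<partial>M)"
    unfolding p_def Bernstein_def mult.assoc
    by (simp only: Bochner_Integration.integral_sum integrable_mult_right intXB intYB integral_mult_right_zero)
      (intro tendsto_intros Bernstein_moments_tendsto[OF assms(1-6)])
  then obtain n0 where n0: "\<And>n. n \<ge> n0 \<Longrightarrow> \<bar>(\<integral>x. p (X n x) \<partial>N n) - (\<integral>x. p (Y x) \<partial>M)\<bar> < e'"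
    using \<open>e' > 0\<close> unfolding lim_sequentially dist_real_def by blast
  have X_le: "\<bar>(\<integral>x. f (X n x) \<partial>N n) - (\<integral>x. p (X n x) \<partial>N n)\<bar> \<le> e'" for n
  proof -
    interpret Nn: prob_space "N n" by (rule N)
    have "\<bar>\<integral>x. f (X n x) - p (X n x) \<partial>N n\<bar> \<le> (\<integral>x. \<bar>f (X n x) - p (X n x)\<bar> \<partial>N n)"
      by (rule integral_abs_bound)
    also have "\<dots> \<le> (\<integral>x. e' \<partial>N n)"
      using intXf[of n] intXp[of n]
      by (intro integral_mono_AE eventually_mono[OF X01]) (auto intro!: p simp del: atLeastAtMost_iff)
    finally show ?thesis using intXf[of n] intXp[of n] by (simp add: Nn.prob_space)
  qed
  have Y_le: "\<bar>(\<integral>x. f (Y x) \<partial>M) - (\<integral>x. p (Y x) \<partial>M)\<bar> \<le> e'"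
  proof -
    have "\<bar>\<integral>x. f (Y x) - p (Y x) \<partial>M\<bar> \<le> (\<integral>x. \<bar>f (Y x) - p (Y x)\<bar> \<partial>M)"
      by (rule integral_abs_bound)
    also have "\<dots> \<le> (\<integral>x. e' \<partial>M)"
      using intYf intYp
      by (intro integral_mono_AE eventually_mono[OF Y01]) (auto intro!: p simp del: atLeastAtMost_iff)
    finally show ?thesis using intYf intYp by (simp add: prob_space)
  qed
  have "\<bar>(\<integral>x. f (X n x) \<partial>N n) - (\<integral>x. f (Y x) \<partial>M)\<bar> < e" if "n \<ge> n0" for n
    using n0[OF that] X_le[of n] Y_le \<open>0 < e\<close> unfolding e'_def by linarith
  then show "\<exists>n0. \<forall>n\<ge>n0. norm ((\<integral>x. f (X n x) \<partial>N n) - (\<integral>x. f (Y x) \<partial>M)) < e"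
    by auto
qed

text \<open>In the variable \<^term>\<open>exp (- x)\<close> the Laplace transforms at integers are moments on the unit interval.\<close>

theorem Laplace_transform_tendsto_imp_weak_conv:
  fixes N :: "nat \<Rightarrow> real measure" and M :: "real measure"
  assumes N: "\<And>n. real_distribution (N n)" and M: "real_distribution M"
    and N0: "\<And>n. AE x in N n. 0 \<le> x" and M0: "AE x in M. 0 \<le> x"
    and lim: "\<And>j::nat. (\<lambda>n. \<integral>x. exp (- (real j * x)) \<partial>N n) \<longlonglongrightarrow> (\<integral>x. exp (- (real j * x)) \<partial>M)"
  shows "weak_conv_m N M"
proof (rule integral_cts_step_conv_imp_weak_conv[OF N M])
  fix a b :: real assume "a < b"
  interpret M: real_distribution M by fact
  have [measurable_cong]: "sets (N n) = sets borel" for n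
    using N[of n] by (simp add: real_distribution_def real_distribution_axioms_def)
  \<comment> \<open>The step function is pulled back along \<open>x = - ln u\<close>. Truncating
    \<open>u\<close> at \<open>exp (- b)\<close> avoids the singularity of \<open>ln\<close> at 0
    and changes nothing, since \<open>cts_step a b\<close> vanishes from \<open>b\<close>
    on.\<close>
  define f where "f u = cts_step a b (- ln (max u (exp (- b))))" for u
  have max_pos: "max u (exp (- b)) > 0" for u by (simp add: less_max_iff_disj)
  have "continuous_on UNIV (cts_step a b)"
    using cts_step_uniformly_continuous[OF \<open>a < b\<close>] uniformly_continuous_imp_continuous by blast
  then have f: "continuous_on UNIV f"
    unfolding f_def
    by (rule continuous_on_compose2) (auto intro!: continuous_intros simp: max_pos[THEN less_imp_neq, symmetric])
  have f_exp: "f (exp (- x)) = cts_step a b x" for x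
    using \<open>a < b\<close> by (cases "x \<le> b") (auto simp: f_def max_def cts_step_def)
  have "(\<lambda>n. \<integral>x. f (exp (- x)) \<partial>N n) \<longlonglongrightarrow> (\<integral>x. f (exp (- x)) \<partial>M)"
  proof (rule M.moments_tendsto_imp_integral_tendsto[OF _ _ _ _ _ _ f])
    show "prob_space (N n)" for n using N[of n] by (simp add: real_distribution_def)
    show "AE x in N n. exp (- x) \<in> {0..1}" for n using N0[of n] by (auto elim!: eventually_mono)
    show "AE x in M. exp (- x) \<in> {0..1}" using M0 by (auto elim!: eventually_mono)
    show "(\<lambda>n. \<integral>x. exp (- x) ^ j \<partial>N n) \<longlonglongrightarrow> (\<integral>x. exp (- x) ^ j \<partial>M)" for j
      using lim[of j] by (simp add: exp_of_nat_mult[symmetric])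
  qed measurable
  then show "(\<lambda>n. integral\<^sup>L (N n) (cts_step a b)) \<longlonglongrightarrow> integral\<^sup>L M (cts_step a b)"
    by (simp add: f_exp)
qed

section \<open>Eigenbases of symmetric matrices\<close>

text \<open>A maximiser \<open>x\<close> of the Rayleigh quotient on the unit sphere of
  \<open>S\<close> is an eigenvector: its residual \<open>r = f x - l x\<close> lies in
  \<open>S\<close>, and moving from \<open>x\<close> in the direction \<open>r\<close> would
  increase the quotient unless \<open>r = 0\<close>.\<close>

lemma self_adjoint_eigenvector_in_subspace:
  fixes f :: "'a::euclidean_space \<Rightarrow> 'a"
  assumes f: "linear f" and sa: "\<And>x y. f x \<bullet> y = x \<bullet> f y"
    and S: "subspace S" and inv: "f ` S \<subseteq> S" and nz: "S \<noteq> {0}"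
  obtains x l where "x \<in> S" "norm x = 1" "f x = l *\<^sub>R x"
proof -
  have cpt: "compact (S \<inter> sphere 0 1)"
    by (intro closed_Int_compact closed_subspace S compact_sphere)
  obtain y where y: "y \<in> S" "y \<noteq> 0" using nz subspace_0[OF S] by auto
  then have "(1 / norm y) *\<^sub>R y \<in> S \<inter> sphere 0 1" using S by (auto simp: subspace_scale)
  then have ne: "S \<inter> sphere 0 1 \<noteq> {}" by blast
  have cont: "continuous_on (S \<inter> sphere 0 1) (\<lambda>x. x \<bullet> f x)"
    by (intro continuous_intros linear_continuous_on f[THEN linear_conv_bounded_linear[THEN iffD1]])
  obtain x where x: "x \<in> S \<inter> sphere 0 1"
    and max: "\<And>z. z \<in> S \<inter> sphere 0 1 \<Longrightarrow> z \<bullet> f z \<le> x \<bullet> f x"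
    using continuous_attains_sup[OF cpt ne cont] by blast
  define l where "l = x \<bullet> f x"
  have le: "z \<bullet> f z \<le> l * (z \<bullet> z)" if "z \<in> S" for z
  proof (cases "z = 0")
    case False
    with that S have "(1 / norm z) *\<^sub>R z \<in> S \<inter> sphere 0 1" by (auto simp: subspace_scale)
    from max[OF this] have "(z \<bullet> f z) / (norm z)\<^sup>2 \<le> l"
      by (simp add: linear_cmul[OF f] l_def power2_eq_square)
    with False show ?thesis by (simp add: divide_le_eq power2_norm_eq_inner)
  qed (use f in \<open>simp add: linear_0\<close>)
  define r where "r = f x - l *\<^sub>R x"
  have "r \<in> S" using x inv S by (auto simp: r_def intro!: subspace_diff subspace_scale)
  have xx: "x \<bullet> x = 1" using x by (simp add: dot_square_norm)
  have xfr: "x \<bullet> f r = r \<bullet> f x" by (subst sa[symmetric]) (rule inner_commute)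
  have "r \<bullet> r = r \<bullet> f x - l * (r \<bullet> x)"
    by (simp only: r_def[symmetric] inner_diff_right[symmetric] inner_scaleR_right[symmetric])
  then have rfx: "r \<bullet> f x = r \<bullet> r + l * (r \<bullet> x)" by simp
  \<comment> \<open>Maximality is applied at \<open>x + t r\<close>, which is not a unit vector;
    hence the homogeneous form \<open>le\<close>. The terms linear in \<open>t\<close> on the two
    sides differ by exactly \<open>2 t (r \<bullet> r)\<close>.\<close>
  have ineq: "2 * t * (r \<bullet> r) \<le> t\<^sup>2 * (l * (r \<bullet> r) - r \<bullet> f r)" for t
  proof -
    have "x + t *\<^sub>R r \<in> S" using x \<open>r \<in> S\<close> S by (auto intro!: subspace_add subspace_scale)
    from le[OF this] have "l + 2 * t * (r \<bullet> f x) + t\<^sup>2 * (r \<bullet> f r) \<le> l * (1 + 2 * t * (r \<bullet> x) + t\<^sup>2 * (r \<bullet> r))"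
      by (simp only: linear_add[OF f] linear_cmul[OF f] inner_add_left inner_add_right inner_scaleR_left
        inner_scaleR_right inner_commute[of x r] xx l_def[symmetric] xfr) (simp add: algebra_simps power2_eq_square)
    then show ?thesis unfolding rfx by (simp add: algebra_simps)
  qed
  have "r \<bullet> r = 0"
  proof (rule ccontr)
    assume "r \<bullet> r \<noteq> 0"
    then have pos: "r \<bullet> r > 0" by (simp only: inner_gt_zero_iff inner_eq_zero_iff not_False_eq_True)
    \<comment> \<open>For \<open>t = (r \<bullet> r) / C\<close> the quadratic side is at most half
      of the linear side, which is absurd unless \<open>r\<close> vanishes. Adding 1 keeps
      \<open>C\<close> positive.\<close>
    define C where "C = \<bar>l * (r \<bullet> r) - r \<bullet> f r\<bar> + 1"
    have "2 * ((r \<bullet> r) / C) * (r \<bullet> r) \<le> ((r \<bullet> r) / C)\<^sup>2 * C"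
      by (rule order_trans[OF ineq]) (auto simp: C_def intro!: mult_left_mono)
    also have "\<dots> = ((r \<bullet> r) / C) * (r \<bullet> r)" using C_def by (simp add: power2_eq_square)
    finally have "((r \<bullet> r) / C) * (r \<bullet> r) \<le> 0" by linarith
    moreover have "((r \<bullet> r) / C) * (r \<bullet> r) > 0" using pos by (auto simp: C_def intro!: mult_pos_pos divide_pos_pos)
    ultimately show False by linarith
  qed
  then have "f x = l *\<^sub>R x" by (simp add: r_def)
  with x show thesis by (intro that) auto
qed

text \<open>Induction on the dimension: a unit eigenvector \<open>x\<close> is split off, and its
  orthogonal complement within \<open>S\<close> is again invariant because \<open>f\<close> is
  self-adjoint.\<close>

lemma self_adjoint_eigenbasis_subspace:
  fixes f :: "'a::euclidean_space \<Rightarrow> 'a"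
  assumes f: "linear f" and sa: "\<And>x y. f x \<bullet> y = x \<bullet> f y"
    and S: "subspace S" and inv: "f ` S \<subseteq> S"
  obtains B where "B \<subseteq> S" "S \<subseteq> span B" "pairwise orthogonal B"
    "\<And>x. x \<in> B \<Longrightarrow> norm x = 1" "\<And>x. x \<in> B \<Longrightarrow> \<exists>l. f x = l *\<^sub>R x"
  using S inv
proof (induction "dim S" arbitrary: S thesis rule: less_induct)
  case less
  show ?case
  proof (cases "S = {0}")
    case True
    show ?thesis by (rule less.prems(1)[of "{}"]) (auto simp: True)
  next
    case False
    then obtain x l where x: "x \<in> S" "norm x = 1" "f x = l *\<^sub>R x"
      using self_adjoint_eigenvector_in_subspace[OF f sa less.prems(2,3)] by blast
    have xx: "x \<bullet> x = 1" using x by (simp add: dot_square_norm)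
    define S' where "S' = S \<inter> {y. x \<bullet> y = 0}"
    have S': "subspace S'" unfolding S'_def
      using less.prems(2) subspace_hyperplane by (rule subspace_inter)
    have inv': "f ` S' \<subseteq> S'"
      using less.prems(3) by (auto simp: S'_def sa[symmetric] x(3))
    have "x \<notin> S'" by (simp add: S'_def xx)
    then have "S' \<subset> S" using x(1) unfolding S'_def by blast
    then have "dim S' < dim S"
      using dim_psubset[of S' S] S' less.prems(2) by (simp add: span_eq_iff[THEN iffD2])
    from less.hyps[OF this _ S' inv'] obtain B where B: "B \<subseteq> S'" "S' \<subseteq> span B" "pairwise orthogonal B"
       "\<And>x. x \<in> B \<Longrightarrow> norm x = 1" "\<And>x. x \<in> B \<Longrightarrow> \<exists>l. f x = l *\<^sub>R x"
      by metis
    show ?thesis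
    proof (rule less.prems(1)[of "insert x B"])
      show "S \<subseteq> span (insert x B)"
      proof
        fix y assume "y \<in> S"
        have "y - (x \<bullet> y) *\<^sub>R x \<in> S'"
          using \<open>y \<in> S\<close> x(1) less.prems(2) xx
          by (auto simp: S'_def inner_diff_right intro!: subspace_diff subspace_scale)
        then have "y - (x \<bullet> y) *\<^sub>R x \<in> span B" using B(2) by blast
        then show "y \<in> span (insert x B)" by (auto simp: span_insert)
      qed
    qed (use B x in \<open>auto simp: S'_def pairwise_insert orthogonal_def inner_commute\<close>)
  qed
qed

text \<open>The basis is indexed by the coordinate type \<open>'m\<close> itself, so that the
  eigenvectors can serve as the columns or rows of a square matrix.\<close>

theorem symmetric_matrix_eigenbasis:
  fixes V :: "real^'m^'m"
  assumes "transpose V = V"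
  obtains q :: "'m \<Rightarrow> real^'m" and d :: "'m \<Rightarrow> real"
  where "\<And>i j. q i \<bullet> q j = (if i = j then 1 else 0)" "\<And>i. V *v q i = d i *\<^sub>R q i"
proof -
  have sa: "(V *v x) \<bullet> y = x \<bullet> (V *v y)" for x y
    by (metis assms dot_lmul_matrix transpose_matrix_vector)
  obtain B where B: "UNIV \<subseteq> span B" "pairwise orthogonal B"
    "\<And>x. x \<in> B \<Longrightarrow> norm x = 1" "\<And>x. x \<in> B \<Longrightarrow> \<exists>l. V *v x = l *\<^sub>R x"
    using self_adjoint_eigenbasis_subspace[OF matrix_vector_mul_linear sa subspace_UNIV] by auto
  have "0 \<notin> B" using B(3) by fastforce
  then have ind: "independent B" using B(2) pairwise_orthogonal_independent by blast
  have "card B = CARD('m)"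
    using B(1) ind basis_card_eq_dim[of B UNIV] by (simp add: dim_UNIV)
  then obtain q :: "'m \<Rightarrow> real^'m" where q: "bij_betw q UNIV B"
    using finite_same_card_bij[of "UNIV :: 'm set" B] independent_imp_finite[OF ind] by auto
  have qB: "q i \<in> B" for i using q by (auto simp: bij_betw_def)
  have "q i \<bullet> q j = (if i = j then 1 else 0)" for i j
  proof (cases "i = j")
    case False
    then have "q i \<noteq> q j" using q by (auto simp: bij_betw_def inj_on_def)
    then show ?thesis using B(2) qB[of i] qB[of j] False by (auto simp: pairwise_def orthogonal_def)
  qed (use B(3) qB in \<open>simp add: dot_square_norm\<close>)
  then show thesis
    using that[of q "\<lambda>i. SOME l. V *v q i = l *\<^sub>R q i"] someI_ex[OF B(4)[OF qB]] by blast
qed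

section \<open>Characteristic polynomials and lists of eigenvalues\<close>

lemma poly_charpoly: "poly (charpoly A) x = det (x *\<^sub>R mat 1 - A)"
  unfolding charpoly_def det_def
  by (auto simp: poly_sum poly_prod mat_def intro!: sum.cong prod.cong)

text \<open>With the eigenvectors as columns of \<open>Q\<close> one has
  \<open>V ** Q = Q ** D\<close>, so \<open>x I - V\<close> and \<open>x I - D\<close> have the same
  determinant for every real \<open>x\<close>. Real polynomials that agree at every point are
  equal.\<close>

lemma charpoly_eigenbasis:
  fixes V :: "real^'m^'m" and q :: "'m \<Rightarrow> real^'m"
  assumes q: "\<And>i j. q i \<bullet> q j = (if i = j then 1 else 0)" and V: "\<And>i. V *v q i = d i *\<^sub>R q i"
  shows "charpoly V = (\<Prod>i\<in>UNIV. [:- d i, 1:])"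
proof -
  define Q D :: "real^'m^'m" where "Q = (\<chi> i j. q j $ i)" and "D = (\<chi> i j. if i = j then d i else 0)"
  have QQ: "transpose Q ** Q = mat 1"
    by (auto simp: vec_eq_iff Q_def transpose_def matrix_matrix_mult_def mat_def q[unfolded inner_vec_def, simplified])
  then have QQ': "Q ** transpose Q = mat 1" by (simp add: matrix_left_right_inverse)
  have "V ** Q = Q ** D"
    using V by (auto simp: vec_eq_iff Q_def D_def matrix_matrix_mult_def matrix_vector_mult_def if_distrib cong: if_cong)
  have "poly (charpoly V) x = poly (\<Prod>i\<in>UNIV. [:- d i, 1:]) x" for x
  proof -
    have "(x *\<^sub>R mat 1 - V) ** Q = x *\<^sub>R (mat 1 ** Q) - V ** Q"
      by (simp add: vec_eq_iff matrix_matrix_mult_def left_diff_distrib sum_subtractf mult.assoc sum_distrib_left)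
    moreover have "Q ** (x *\<^sub>R mat 1 - D) = x *\<^sub>R (Q ** mat 1) - Q ** D"
      by (simp add: vec_eq_iff matrix_matrix_mult_def right_diff_distrib sum_subtractf mult.left_commute sum_distrib_left)
    ultimately have "(x *\<^sub>R mat 1 - V) ** Q = Q ** (x *\<^sub>R mat 1 - D)"
      using \<open>V ** Q = Q ** D\<close> by simp
    then have "det (x *\<^sub>R mat 1 - V) * det Q = det Q * det (x *\<^sub>R mat 1 - D)"
      by (metis det_mul)
    moreover have "det Q \<noteq> 0" using QQ by (metis det_I det_mul mult_zero_right zero_neq_one)
    ultimately have "det (x *\<^sub>R mat 1 - V) = det (x *\<^sub>R mat 1 - D)" by simp
    also have "\<dots> = (\<Prod>i\<in>UNIV. x - d i)"
      by (subst det_diagonal) (auto simp: D_def mat_def)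
    finally show ?thesis by (simp add: poly_charpoly poly_prod)
  qed
  then show ?thesis by (simp add: poly_eq_poly_eq_iff[symmetric] fun_eq_iff)
qed

lemma proots_prod_linear_factors:
  fixes f :: "'a \<Rightarrow> 'b::idom"
  assumes "finite A"
  shows "proots (\<Prod>i\<in>A. [:- f i, 1:]) = image_mset f (mset_set A)"
  using assms
proof (induction A)
  case (insert x A)
  then show ?case by (simp add: proots_mult prod_zero_iff del: mult_pCons_left)
qed simp

text \<open>Both families are the roots of the same polynomial, with multiplicity. The order of
  \<open>lam\<close> is left open by \<open>eigenvalue_list\<close>, so only multisets can be
  compared; this suffices for products over all eigenvalues.\<close>

lemma image_mset_eigenvalue_list:
  fixes V :: "real^'m^'m" and q :: "'m \<Rightarrow> real^'m"
  assumes q: "\<And>i j. q i \<bullet> q j = (if i = j then 1 else 0)" and V: "\<And>i. V *v q i = d i *\<^sub>R q i"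
    and lam: "eigenvalue_list V m lam"
  shows "image_mset lam (mset_set {1..m}) = image_mset d (mset_set UNIV)"
proof -
  have "(\<Prod>k\<in>{1..m}. [:- lam k, 1:]) = (\<Prod>i\<in>UNIV. [:- d i, 1:])"
    using charpoly_eigenbasis[OF q V] lam unfolding eigenvalue_list_def by simp
  then show ?thesis
    by (metis finite_atLeastAtMost finite_class.finite_UNIV proots_prod_linear_factors)
qed

section \<open>Gaussian quadratic forms\<close>

text \<open>The square matrix with rows \<open>q i\<close> has a right inverse, its transpose, which
  is then also a left inverse; so it preserves inner products.\<close>

lemma orthonormal_family_Parseval:
  fixes q :: "'m \<Rightarrow> real^'m"
  assumes q: "\<And>i j. q i \<bullet> q j = (if i = j then 1 else 0)"
  shows "(\<Sum>i\<in>UNIV. (q i \<bullet> x)\<^sup>2) = x \<bullet> x"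
proof -
  define Q :: "real^'m^'m" where "Q = (\<chi> i. q i)"
  have "Q ** transpose Q = mat 1"
    by (simp add: vec_eq_iff Q_def transpose_def matrix_matrix_mult_def mat_def q[unfolded inner_vec_def, simplified])
  then have "transpose Q ** Q = mat 1" by (simp add: matrix_left_right_inverse)
  then have "orthogonal_transformation ((*v) Q)"
    by (simp add: orthogonal_transformation_matrix matrix_of_matrix_vector_mul orthogonal_matrix)
  then have "(Q *v x) \<bullet> (Q *v x) = x \<bullet> x" by (simp add: orthogonal_transformation_def)
  moreover have "(Q *v x) $ i = q i \<bullet> x" for i
    by (simp add: Q_def matrix_vector_mult_def inner_vec_def)
  ultimately show ?thesis by (simp add: inner_vec_def[of "Q *v x"] power2_eq_square)
qed

lemma quadratic_form_eigenbasis: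
  fixes q :: "'m \<Rightarrow> real^'m"
  assumes q: "\<And>i j. q i \<bullet> q j = (if i = j then 1 else 0)" and V: "\<And>i. V *v q i = d i *\<^sub>R q i"
  shows "(\<Sum>i\<in>UNIV. z i *\<^sub>R q i) \<bullet> (V *v (\<Sum>i\<in>UNIV. z i *\<^sub>R q i)) = (\<Sum>i\<in>UNIV. d i * (z i)\<^sup>2)"
proof -
  have "V *v (\<Sum>i\<in>UNIV. z i *\<^sub>R q i) = (\<Sum>i\<in>UNIV. (z i * d i) *\<^sub>R q i)"
    by (simp add: linear_sum[OF matrix_vector_mul_linear] linear_cmul[OF matrix_vector_mul_linear] V)
  then show ?thesis
    by (simp add: inner_sum_left inner_sum_right q power2_eq_square mult_ac if_distrib[of "\<lambda>x. _ * x"] cong: if_cong)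
qed

text \<open>The Gaussian characteristic function read backwards: coordinate \<open>i\<close>
  contributes \<open>exp (- s (q i \<bullet> x)^2)\<close>, where the factor
  \<open>sqrt (2 * s)\<close> absorbs the 1/2 in \<open>exp (- t^2 / 2)\<close>, and Parseval's
  identity collects the exponents.\<close>

lemma Gaussian_linearization:
  fixes q :: "'m \<Rightarrow> real^'m"
  assumes q: "\<And>i j. q i \<bullet> q j = (if i = j then 1 else 0)" and "0 \<le> s"
  shows "(CLINT z|Pi\<^sub>M UNIV (\<lambda>_. std_normal_distribution). iexp ((sqrt (2 * s) *\<^sub>R (\<Sum>i\<in>UNIV. z i *\<^sub>R q i)) \<bullet> x)) =
    complex_of_real (exp (- (s * (x \<bullet> x))))"
proof -
  interpret N: real_distribution std_normal_distribution by (rule real_dist_normal_dist)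
  interpret product_sigma_finite "\<lambda>_::'m. std_normal_distribution" ..
  define t where "t i = sqrt (2 * s) * (q i \<bullet> x)" for i
  have "(sqrt (2 * s) *\<^sub>R (\<Sum>i\<in>UNIV. z i *\<^sub>R q i)) \<bullet> x = (\<Sum>i\<in>UNIV. t i * z i)" for z
    by (simp add: inner_sum_left t_def sum_distrib_left mult_ac)
  then have "(CLINT z|Pi\<^sub>M UNIV (\<lambda>_. std_normal_distribution). iexp ((sqrt (2 * s) *\<^sub>R (\<Sum>i\<in>UNIV. z i *\<^sub>R q i)) \<bullet> x)) =
      (CLINT z|Pi\<^sub>M UNIV (\<lambda>_. std_normal_distribution). (\<Prod>i\<in>UNIV. iexp (t i * z i)))"
    by (simp add: exp_sum sum_distrib_left)
  also have "\<dots> = (\<Prod>i\<in>UNIV. char std_normal_distribution (t i))"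
    unfolding char_def by (intro product_integral_prod N.integrable_iexp) auto
  also have "\<dots> = complex_of_real (\<Prod>i\<in>UNIV. exp (- (s * (q i \<bullet> x)\<^sup>2)))"
    using \<open>0 \<le> s\<close> by (simp add: char_std_normal_distribution t_def power_mult_distrib)
  also have "\<dots> = complex_of_real (exp (- (s * (\<Sum>i\<in>UNIV. (q i \<bullet> x)\<^sup>2))))"
    by (simp only: exp_sum[symmetric, OF finite_class.finite_UNIV] sum_negf sum_distrib_left)
  finally show ?thesis by (simp add: orthonormal_family_Parseval[OF q])
qed

text \<open>Linearization and Fubini express the Laplace transform as a Gaussian average of the
  characteristic functions of \<open>X n\<close> at the random frequency \<open>a z\<close>. These
  are bounded by 1, so their pointwise limit passes through the average, and the limit factorizes in
  the eigenbasis.\<close>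

theorem (in prob_space) Laplace_transform_norm_tendsto:
  fixes X :: "nat \<Rightarrow> 'a \<Rightarrow> real^'m" and V :: "real^'m^'m" and q :: "'m \<Rightarrow> real^'m"
  assumes X[measurable]: "\<And>n. X n \<in> borel_measurable M"
    and lim: "\<And>a. (\<lambda>n. CLINT \<omega>|M. iexp (a \<bullet> X n \<omega>)) \<longlonglongrightarrow> exp (- (a \<bullet> (V *v a)) / 2)"
    and q: "\<And>i j. q i \<bullet> q j = (if i = j then 1 else 0)" and V: "\<And>i. V *v q i = d i *\<^sub>R q i"
    and d: "\<And>i. 0 \<le> d i" and "0 \<le> s"
  shows "(\<lambda>n. \<integral>\<omega>. exp (- (s * (X n \<omega> \<bullet> X n \<omega>))) \<partial>M) \<longlonglongrightarrow>
    (\<Prod>i\<in>UNIV. \<integral>z. exp (- (s * d i * z\<^sup>2)) \<partial>std_normal_distribution)"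
proof -
  interpret N: real_distribution std_normal_distribution by (rule real_dist_normal_dist)
  interpret product_prob_space "\<lambda>_::'m. std_normal_distribution" UNIV ..
  interpret P: pair_prob_space M "Pi\<^sub>M (UNIV :: 'm set) (\<lambda>_. std_normal_distribution)" ..
  let ?N = "Pi\<^sub>M (UNIV :: 'm set) (\<lambda>_. std_normal_distribution)"
  define a where "a z = sqrt (2 * s) *\<^sub>R (\<Sum>i\<in>UNIV. z i *\<^sub>R q i)" for z
  have a[measurable]: "a \<in> borel_measurable ?N"
    unfolding a_def by measurable
  have "a z \<bullet> (V *v a z) = 2 * (\<Sum>i\<in>UNIV. s * d i * (z i)\<^sup>2)" for z
    unfolding a_def linear_cmul[OF matrix_vector_mul_linear] inner_scaleR_left inner_scaleR_right
      quadratic_form_eigenbasis[OF q V] mult.assoc[symmetric]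
    using \<open>0 \<le> s\<close> by (simp add: sum_distrib_left mult.assoc)
  then have quad: "exp (- (a z \<bullet> (V *v a z)) / 2) = (\<Prod>i\<in>UNIV. exp (- (s * d i * (z i)\<^sup>2)))" for z
    by (simp add: exp_sum[symmetric] sum_negf)
  have "complex_of_real (\<integral>\<omega>. exp (- (s * (X n \<omega> \<bullet> X n \<omega>))) \<partial>M) = (CLINT z|?N. CLINT \<omega>|M. iexp (a z \<bullet> X n \<omega>))" for n
  proof -
    have "complex_of_real (\<integral>\<omega>. exp (- (s * (X n \<omega> \<bullet> X n \<omega>))) \<partial>M) = (CLINT \<omega>|M. CLINT z|?N. iexp (a z \<bullet> X n \<omega>))"
      unfolding a_def Gaussian_linearization[OF q \<open>0 \<le> s\<close>] by (rule integral_complex_of_real[symmetric])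
    also have "\<dots> = (CLINT z|?N. CLINT \<omega>|M. iexp (a z \<bullet> X n \<omega>))"
      by (rule P.Fubini_integral[symmetric], rule P.integrable_const_bound[of _ 1]) auto
    finally show ?thesis .
  qed
  moreover have "(\<lambda>n. CLINT z|?N. CLINT \<omega>|M. iexp (a z \<bullet> X n \<omega>)) \<longlonglongrightarrow>
      (CLINT z|?N. complex_of_real (\<Prod>i\<in>UNIV. exp (- (s * d i * (z i)\<^sup>2))))"
  proof (rule integral_dominated_convergence[where w="\<lambda>_. 1"])
    show "AE z in ?N. norm (CLINT \<omega>|M. iexp (a z \<bullet> X n \<omega>)) \<le> 1" for n
    proof (intro AE_I2 order_trans[OF integral_norm_bound])
      show "(\<integral>\<omega>. norm (iexp (a z \<bullet> X n \<omega>)) \<partial>M) \<le> 1" for z by (simp add: prob_space)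
    qed
    show "AE z in ?N. (\<lambda>n. CLINT \<omega>|M. iexp (a z \<bullet> X n \<omega>)) \<longlonglongrightarrow>
        complex_of_real (\<Prod>i\<in>UNIV. exp (- (s * d i * (z i)\<^sup>2)))"
      using lim by (simp add: quad[symmetric])
  qed auto
  moreover have "(CLINT z|?N. complex_of_real (\<Prod>i\<in>UNIV. exp (- (s * d i * (z i)\<^sup>2)))) =
      complex_of_real (\<Prod>i\<in>UNIV. \<integral>z. exp (- (s * d i * z\<^sup>2)) \<partial>std_normal_distribution)"
    unfolding integral_complex_of_real of_real_eq_iff
    using \<open>0 \<le> s\<close> d
    by (intro product_integral_prod N.integrable_const_bound[of _ 1]) auto
  ultimately have "(\<lambda>n. complex_of_real (\<integral>\<omega>. exp (- (s * (X n \<omega> \<bullet> X n \<omega>))) \<partial>M)) \<longlonglongrightarrow>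
      complex_of_real (\<Prod>i\<in>UNIV. \<integral>z. exp (- (s * d i * z\<^sup>2)) \<partial>std_normal_distribution)"
    by (simp only:)
  then show ?thesis by (simp only: tendsto_of_real_iff)
qed

section \<open>The law of a weighted sum of squared Gaussians, and its quantiles\<close>

lemma real_distribution_weighted_chisq: "real_distribution (weighted_chisq m lam)"
proof -
  interpret N: real_distribution std_normal_distribution by (rule real_dist_normal_dist)
  interpret product_prob_space "\<lambda>_::nat. std_normal_distribution" "{1..m}" ..
  show ?thesis unfolding weighted_chisq_def by (rule P.real_distribution_distr) measurable
qed

lemma AE_weighted_chisq_nonneg:
  assumes "\<And>k. k \<in> {1..m} \<Longrightarrow> 0 \<le> lam k"
  shows "AE x in weighted_chisq m lam. 0 \<le> x"
  unfolding weighted_chisq_def using assms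
  by (subst AE_distr_iff) (auto intro!: sum_nonneg)

lemma Laplace_transform_weighted_chisq:
  assumes lam: "\<And>k. k \<in> {1..m} \<Longrightarrow> 0 \<le> lam k" and "0 \<le> s"
  shows "(\<integral>x. exp (- (s * x)) \<partial>weighted_chisq m lam) =
    (\<Prod>k\<in>{1..m}. \<integral>z. exp (- (s * lam k * z\<^sup>2)) \<partial>std_normal_distribution)"
proof -
  interpret N: real_distribution std_normal_distribution by (rule real_dist_normal_dist)
  interpret product_prob_space "\<lambda>_::nat. std_normal_distribution" "{1..m}" ..
  have "(\<integral>x. exp (- (s * x)) \<partial>weighted_chisq m lam) =
      (\<integral>z. (\<Prod>k\<in>{1..m}. exp (- (s * lam k * (z k)\<^sup>2))) \<partial>Pi\<^sub>M {1..m} (\<lambda>_. std_normal_distribution))"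
    unfolding weighted_chisq_def
    by (subst integral_distr) (simp_all add: exp_sum[symmetric] sum_negf sum_distrib_left mult.assoc)
  also have "\<dots> = (\<Prod>k\<in>{1..m}. \<integral>z. exp (- (s * lam k * z\<^sup>2)) \<partial>std_normal_distribution)"
    using \<open>0 \<le> s\<close> lam
    by (intro product_integral_prod N.integrable_const_bound[of _ 1]) auto
  finally show ?thesis .
qed

text \<open>If all coordinates but one with nonzero weight are fixed, the remaining one is confined
  to at most two points, a null set for the normal law.\<close>

lemma measure_weighted_chisq_singleton:
  assumes k: "k \<in> {1..m}" "lam k \<noteq> 0"
  shows "measure (weighted_chisq m lam) {c} = 0"
proof -
  interpret N: real_distribution std_normal_distribution by (rule real_dist_normal_dist)
  interpret product_prob_space "\<lambda>_::nat. std_normal_distribution" "{1..m}" ..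
  define I where "I = {1..m} - {k}"
  have I: "finite I" "k \<notin> I" "{1..m} = insert k I" using k by (auto simp: I_def)
  let ?N = "\<lambda>J. Pi\<^sub>M J (\<lambda>_::nat. std_normal_distribution)"
  have "emeasure (weighted_chisq m lam) {c} =
      (\<integral>\<^sup>+ z. indicator {c} (\<Sum>k\<in>{1..m}. lam k * (z k)\<^sup>2) \<partial>?N {1..m})"
    unfolding weighted_chisq_def
    by (subst nn_integral_indicator[symmetric], simp, subst nn_integral_distr) auto
  also have "\<dots> = (\<integral>\<^sup>+ z. \<integral>\<^sup>+ y. indicator {c} (\<Sum>j\<in>insert k I. lam j * ((z(k := y)) j)\<^sup>2) \<partial>std_normal_distribution \<partial>?N I)"
    unfolding I(3)
  proof (rule product_nn_integral_insert[OF I(1,2)])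
    have "(\<lambda>z. indicator {c} (\<Sum>k\<in>{1..m}. lam k * (z k)\<^sup>2) :: ennreal) \<in> borel_measurable (?N {1..m})"
      by measurable
    then show "(\<lambda>z. indicator {c} (\<Sum>k\<in>insert k I. lam k * (z k)\<^sup>2) :: ennreal) \<in> borel_measurable (?N (insert k I))"
      unfolding I(3) .
  qed
  also have "\<dots> = (\<integral>\<^sup>+ z. 0 \<partial>?N I)"
  proof (intro nn_integral_cong)
    fix z
    \<comment> \<open>The value that \<open>y^2\<close> must have. For negative \<open>r\<close> no
      \<open>y\<close> qualifies, and the inclusion below holds trivially.\<close>
    define r where "r = (c - (\<Sum>j\<in>I. lam j * (z j)\<^sup>2)) / lam k"
    have sub: "{y. lam k * y\<^sup>2 + (\<Sum>j\<in>I. lam j * (z j)\<^sup>2) = c} \<subseteq> {sqrt r, - sqrt r}"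
    proof
      fix y assume "y \<in> {y. lam k * y\<^sup>2 + (\<Sum>j\<in>I. lam j * (z j)\<^sup>2) = c}"
      then have "r = y\<^sup>2" using k(2) by (simp add: r_def field_simps)
      then show "y \<in> {sqrt r, - sqrt r}" by (auto simp: abs_if)
    qed
    have "(\<integral>\<^sup>+ y. indicator {c} (\<Sum>j\<in>insert k I. lam j * ((z(k := y)) j)\<^sup>2) \<partial>std_normal_distribution) =
        (\<integral>\<^sup>+ y. indicator {y. lam k * y\<^sup>2 + (\<Sum>j\<in>I. lam j * (z j)\<^sup>2) = c} y \<partial>std_normal_distribution)"
    proof (intro nn_integral_cong)
      fix y
      have "(\<Sum>j\<in>I. lam j * ((z(k := y)) j)\<^sup>2) = (\<Sum>j\<in>I. lam j * (z j)\<^sup>2)"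
        using I(2) by (intro sum.cong) auto
      then show "indicator {c} (\<Sum>j\<in>insert k I. lam j * ((z(k := y)) j)\<^sup>2) =
          (indicator {y. lam k * y\<^sup>2 + (\<Sum>j\<in>I. lam j * (z j)\<^sup>2) = c} y :: ennreal)"
        using I(1,2) by (simp add: indicator_def)
    qed
    also have "\<dots> \<le> (\<integral>\<^sup>+ y. indicator {sqrt r, - sqrt r} y \<partial>std_normal_distribution)"
      using sub by (intro nn_integral_mono) (auto simp: indicator_def)
    also have "\<dots> = emeasure std_normal_distribution {sqrt r, - sqrt r}"
      by (rule nn_integral_indicator) auto
    also have "\<dots> = 0"
      by (subst emeasure_density)
        (auto intro!: nn_integral_0_iff_AE[THEN iffD2] AE_I[where N="{sqrt r, - sqrt r}"] emeasure_lborel_countable simp: indicator_def)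
    finally show "(\<integral>\<^sup>+ y. indicator {c} (\<Sum>j\<in>insert k I. lam j * ((z(k := y)) j)\<^sup>2) \<partial>std_normal_distribution) = 0"
      by simp
  qed
  finally show ?thesis by (simp add: measure_def)
qed

text \<open>Without atoms the distribution function is continuous: it takes the value
  \<open>p\<close> at some \<open>x\<close>, and the infimum belongs to the closed set
  \<open>A\<close>. Monotonicity then gives
  \<open>p \<le> cdf D (Inf A) \<le> cdf D x = p\<close>.\<close>

lemma cdf_quantile:
  assumes "real_distribution D" and "0 < p" "p < 1" and nonatomic: "\<And>x. measure D {x} = 0"
  shows "cdf D (quantile D p) = p"
proof -
  interpret real_distribution D by fact
  have cont: "isCont (cdf D) x" for x by (simp add: isCont_cdf nonatomic)
  define A where "A = {x. p \<le> cdf D x}"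
  have "eventually (\<lambda>x. cdf D x < p) at_bot"
    using order_tendstoD(2)[OF cdf_lim_at_bot \<open>0 < p\<close>] .
  then obtain a where a: "\<And>x. x \<le> a \<Longrightarrow> cdf D x < p" unfolding eventually_at_bot_linorder by auto
  have "eventually (\<lambda>x. p < cdf D x) at_top"
    using order_tendstoD(1)[OF cdf_lim_at_top_prob \<open>p < 1\<close>] .
  then obtain b where b: "p < cdf D b" unfolding eventually_at_top_linorder by auto
  have "a \<le> x" if "x \<in> A" for x using a[of x] that by (force simp: A_def)
  then have bdd: "bdd_below A" by (rule bdd_belowI)
  have "a \<le> b" using a[of b] b by force
  then obtain x where x: "cdf D x = p"
    using IVT[of "cdf D" a p b] a[of a] b cont by auto
  have "closed A" unfolding A_def by (intro closed_Collect_le continuous_intros continuous_at_imp_continuous_on cont ballI)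
  moreover have "A \<noteq> {}" using x by (auto simp: A_def)
  ultimately have "Inf A \<in> A" using bdd closed_contains_Inf by blast
  moreover have "Inf A \<le> x" using bdd x by (intro cInf_lower) (auto simp: A_def)
  then have "cdf D (Inf A) \<le> p" using x cdf_nondecreasing by blast
  ultimately show ?thesis unfolding quantile_def A_def by simp
qed

section \<open>Reflection invariance of elliptical distributions\<close>

lemma nn_integral_lborel_translate:
  fixes f :: "'a::euclidean_space \<Rightarrow> ennreal"
  assumes [measurable]: "f \<in> borel_measurable borel"
  shows "(\<integral>\<^sup>+ x. f (c + x) \<partial>lborel) = (\<integral>\<^sup>+ x. f x \<partial>lborel)"
  by (subst lborel_distr_plus[of c, symmetric]) (simp add: nn_integral_distr)

text \<open>
  The uniqueness argument for Haar measure, applied to the image of Lebesgue measure under \<open>L\<close>: the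
  proportionality factor is read off from a symmetric neighbourhood of the origin that is invariant
  under \<open>L\<close>.
\<close>

lemma distr_lborel_linear_involution:
  fixes L :: "'a::euclidean_space \<Rightarrow> 'a"
  assumes L: "linear L" and inv: "\<And>x. L (L x) = x"
  shows "distr lborel borel L = lborel"
proof (rule measure_eqI)
  fix A assume "A \<in> sets (distr lborel borel L)"
  then have [measurable]: "A \<in> sets borel" by simp
  have cont: "continuous_on UNIV L"
    using L linear_conv_bounded_linear linear_continuous_on by blast
  then have [measurable]: "L \<in> borel_measurable borel" by (rule borel_measurable_continuous_onI)
  \<comment> \<open>The involution swaps the two summands, so the set is invariant under it. Being
    open and nonempty it has positive measure, being bounded it has finite measure, and so its
    measure can be cancelled at the end.\<close>
  define B where "B = {x. norm x + norm (L x) < 1}"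
  have "open B" unfolding B_def by (intro open_Collect_less continuous_intros cont)
  then have [measurable]: "B \<in> sets borel" by simp
  have "0 \<in> B" using linear_0[OF L] by (simp add: B_def)
  then have "emeasure lborel B \<noteq> 0"
    using open_not_negligible[OF \<open>open B\<close>] negligible_iff_emeasure0[of B] by auto
  have "norm x \<le> 1" if "x \<in> B" for x 
    using that norm_ge_zero[of "L x"] unfolding B_def mem_Collect_eq by linarith
  then have "bounded B" by (rule boundedI)
  then have "emeasure lborel B \<noteq> \<infinity>" using emeasure_bounded_finite by fastforce
  have B_L: "L x \<in> B \<longleftrightarrow> x \<in> B" and B_minus: "- x \<in> B \<longleftrightarrow> x \<in> B" for x
    by (auto simp: B_def inv add.commute linear_neg[OF L])
  have B_eq: "indicator B (y - L x) = (indicator B (- L y + x) :: ennreal)" for x y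
    using B_L[of "y - L x"] B_minus[of "x - L y"] by (simp add: linear_diff[OF L] inv indicator_def)
  have "emeasure (distr lborel borel L) A * emeasure lborel B =
      (\<integral>\<^sup>+ y. (\<integral>\<^sup>+ x. indicator A (L x) * indicator B y \<partial>lborel) \<partial>lborel)"
    by (subst nn_integral_indicator[symmetric], simp, subst nn_integral_distr)
      (simp_all add: nn_integral_multc nn_integral_cmult)
  \<comment> \<open>Translating \<open>x\<close> by \<open>L y\<close> turns \<open>L x\<close> into
    \<open>y + L x\<close>. After the integrals are exchanged, a translation in \<open>y\<close>
    moves this shift from \<open>A\<close> to \<open>B\<close>, where it is harmless by
    symmetry.\<close>
  also have "\<dots> = (\<integral>\<^sup>+ y. (\<integral>\<^sup>+ x. indicator A (L (L y + x)) * indicator B y \<partial>lborel) \<partial>lborel)"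
    by (intro nn_integral_cong nn_integral_lborel_translate[symmetric]) measurable
  also have "\<dots> = (\<integral>\<^sup>+ x. (\<integral>\<^sup>+ y. indicator A (L (L y + x)) * indicator B y \<partial>lborel) \<partial>lborel)"
    by (rule lborel_pair.Fubini') measurable
  also have "\<dots> = (\<integral>\<^sup>+ x. (\<integral>\<^sup>+ y. indicator A y * indicator B (y - L x) \<partial>lborel) \<partial>lborel)"
  proof (rule nn_integral_cong)
    fix x
    show "(\<integral>\<^sup>+ y. indicator A (L (L y + x)) * indicator B y \<partial>lborel) =
        (\<integral>\<^sup>+ y. indicator A y * indicator B (y - L x) \<partial>lborel)"
      using nn_integral_lborel_translate[of "\<lambda>y. indicator A y * indicator B (y - L x)" "L x"]
      by (simp add: linear_add[OF L] inv add.commute)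
  qed
  also have "\<dots> = (\<integral>\<^sup>+ y. (\<integral>\<^sup>+ x. indicator A y * indicator B (y - L x) \<partial>lborel) \<partial>lborel)"
    by (rule lborel_pair.Fubini') measurable
  also have "\<dots> = (\<integral>\<^sup>+ y. indicator A y * (\<integral>\<^sup>+ x. indicator B (- L y + x) \<partial>lborel) \<partial>lborel)"
    unfolding B_eq by (intro nn_integral_cong nn_integral_cmult) measurable
  also have "\<dots> = emeasure lborel A * emeasure lborel B"
    by (subst nn_integral_lborel_translate) (simp_all add: nn_integral_multc)
  finally show "emeasure (distr lborel borel L) A = emeasure lborel A"
    using \<open>emeasure lborel B \<noteq> 0\<close> \<open>emeasure lborel B \<noteq> \<infinity>\<close> by (simp add: mult.commute[of _ "emeasure lborel B"] ennreal_mult_cancel_left)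
qed simp

section \<open>Positive definite matrices and the reflections preserving them\<close>

lemma pos_def_symmetric: "pos_def S \<Longrightarrow> x \<bullet> (S *v y) = y \<bullet> (S *v x)"
  unfolding pos_def_def by (metis dot_lmul_matrix inner_commute transpose_matrix_vector)

lemma pos_def_diag_pos: "pos_def S \<Longrightarrow> 0 < S $ i $ i"
  unfolding pos_def_def
  by (drule conjunct2, drule spec[of _ "axis i 1"])
    (simp add: matrix_vector_mult_basis inner_axis' column_def axis_eq_0_iff)

lemma pos_def_sym_entry: "pos_def S \<Longrightarrow> S $ i $ j = S $ j $ i"
  unfolding pos_def_def by (metis transpose_def vec_lambda_beta)

lemma pos_def_matrix_inv:
  assumes "pos_def S"
  shows "matrix_inv S *v (S *v x) = x" "S *v (matrix_inv S *v x) = x"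
proof -
  have "\<forall>x. S *v x = 0 \<longrightarrow> x = 0" using assms unfolding pos_def_def by fastforce
  then have "\<exists>B. S ** B = mat 1 \<and> B ** S = mat 1"
    unfolding invertible_def[symmetric] by (simp add: matrix_left_invertible_ker invertible_left_inverse)
  then show "matrix_inv S *v (S *v x) = x" "S *v (matrix_inv S *v x) = x"
    unfolding matrix_vector_mul_assoc matrix_inv_def by (metis (mono_tags, lifting) matrix_vector_mul_lid someI_ex)+
qed

text \<open>The reflection along \<open>S *v w\<close> that is orthogonal for the inner product with matrix \<open>S\<inverse>\<close>.\<close>

definition scatter_reflection :: "real^'d^'d \<Rightarrow> real^'d \<Rightarrow> real^'d \<Rightarrow> real^'d" where
  "scatter_reflection S w x = x - (2 * (w \<bullet> x) / (w \<bullet> (S *v w))) *\<^sub>R (S *v w)"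

lemma linear_scatter_reflection: "linear (scatter_reflection S w)"
  by (rule linearI) (simp_all add: scatter_reflection_def algebra_simps add_divide_distrib)

lemma scatter_reflection_involution:
  assumes "pos_def S" "w \<noteq> 0"
  shows "scatter_reflection S w (scatter_reflection S w x) = x"
proof -
  have "w \<bullet> (S *v w) \<noteq> 0" using assms by (auto simp: pos_def_def)
  then have "w \<bullet> scatter_reflection S w x = - (w \<bullet> x)"
    by (simp add: scatter_reflection_def inner_diff_right)
  then show ?thesis
    unfolding scatter_reflection_def[of S w "scatter_reflection S w x"]
    by (simp add: scatter_reflection_def)
qed

text \<open>The terms \<open>2 * b * (w \<bullet> x)\<close> and \<open>b * b * Q\<close> cancel by
  the choice of \<open>b\<close>. The elliptical density depends on \<open>x\<close> only through
  this quadratic form.\<close>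

lemma scatter_reflection_quadratic_form:
  assumes S: "pos_def S" and "w \<noteq> 0"
  shows "scatter_reflection S w x \<bullet> (matrix_inv S *v scatter_reflection S w x) = x \<bullet> (matrix_inv S *v x)"
proof -
  define Q where "Q = w \<bullet> (S *v w)"
  define b where "b = 2 * (w \<bullet> x) / Q"
  have "Q \<noteq> 0" using assms by (auto simp: pos_def_def Q_def)
  have L: "scatter_reflection S w x = x - b *\<^sub>R (S *v w)"
    by (simp add: scatter_reflection_def b_def Q_def)
  have "matrix_inv S *v scatter_reflection S w x = matrix_inv S *v x - b *\<^sub>R w"
    unfolding L
    by (simp only: matrix_vector_mult_diff_distrib linear_cmul[OF matrix_vector_mul_linear] pos_def_matrix_inv[OF S])
  moreover have Swx: "(S *v w) \<bullet> (matrix_inv S *v x) = w \<bullet> x"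
    using pos_def_symmetric[OF S, of "matrix_inv S *v x" w]
    by (simp add: inner_commute pos_def_matrix_inv[OF S])
  ultimately have "scatter_reflection S w x \<bullet> (matrix_inv S *v scatter_reflection S w x) =
      (x - b *\<^sub>R (S *v w)) \<bullet> (matrix_inv S *v x - b *\<^sub>R w)"
    using L by simp
  also have "\<dots> = x \<bullet> (matrix_inv S *v x) - 2 * b * (w \<bullet> x) + b * b * Q"
    by (simp add: Swx Q_def inner_diff_left inner_diff_right inner_commute[of "S *v w" w] inner_commute[of x w]
      algebra_simps)
  also have "\<dots> = x \<bullet> (matrix_inv S *v x)" using \<open>Q \<noteq> 0\<close> by (simp add: b_def)
  finally show ?thesis .
qed

text \<open>For \<open>w = u - v\<close>, equality of the two quadratic forms gives
  \<open>w \<bullet> S w = 2 (u \<bullet> S w)\<close>. The reflection therefore subtracts exactly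
  \<open>w \<bullet> x\<close> from \<open>u \<bullet> x\<close>.\<close>

lemma inner_scatter_reflection_diff:
  assumes S: "pos_def S" and uv: "u \<bullet> (S *v u) = v \<bullet> (S *v v)" "u \<noteq> v"
  shows "u \<bullet> scatter_reflection S (u - v) x = v \<bullet> x"
proof -
  let ?w = "u - v"
  have pos: "?w \<bullet> (S *v ?w) \<noteq> 0" using S uv(2) unfolding pos_def_def by (metis less_irrefl right_minus_eq)
  have "?w \<bullet> (S *v ?w) = 2 * (u \<bullet> (S *v ?w))"
    using uv(1) pos_def_symmetric[OF S, of u v]
    by (simp add: matrix_vector_mult_diff_distrib inner_diff_left inner_diff_right)
  then have "u \<bullet> scatter_reflection S ?w x = u \<bullet> x - ?w \<bullet> x"
    using pos by (simp add: scatter_reflection_def inner_diff_right)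
  then show ?thesis by (simp add: inner_diff_left)
qed

text \<open>The map \<open>T\<close> is the reflection centred at \<open>\<mu>\<close>. It preserves
  both Lebesgue measure and the density, hence the law of \<open>Y\<close>.\<close>

lemma distr_elliptical_scatter_reflection:
  assumes S: "pos_def S" and Y: "distributed M lborel Y (\<lambda>y. ennreal (elliptical_density \<mu> S g y))"
    and "w \<noteq> 0"
  shows "distr M borel (\<lambda>\<omega>. scatter_reflection S w (Y \<omega> - \<mu>)) = distr M borel (\<lambda>\<omega>. Y \<omega> - \<mu>)"
proof -
  let ?L = "scatter_reflection S w"
  define T where "T y = \<mu> + ?L (y - \<mu>)" for y
  define f where "f y = ennreal (elliptical_density \<mu> S g y)" for y
  have [measurable]: "?L \<in> borel_measurable borel"
    using linear_scatter_reflection linear_conv_bounded_linear linear_continuous_on borel_measurable_continuous_onI by blast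
  have [measurable]: "Y \<in> borel_measurable M" "f \<in> borel_measurable borel"
    using Y by (auto simp: distributed_def f_def[abs_def])
  have T[measurable]: "T \<in> borel_measurable borel" unfolding T_def by measurable
  have "distr lborel borel T = distr (distr (distr lborel borel ((+) (- \<mu>))) borel ?L) borel ((+) \<mu>)"
    by (simp add: distr_distr comp_def T_def[abs_def])
  then have T_lborel: "distr lborel borel T = lborel"
    using distr_lborel_linear_involution[OF linear_scatter_reflection scatter_reflection_involution[OF S \<open>w \<noteq> 0\<close>]]
    by (simp add: lborel_distr_plus)
  have fT: "f (T y) = f y" for y
    by (simp add: f_def elliptical_density_def T_def scatter_reflection_quadratic_form[OF S \<open>w \<noteq> 0\<close>])
  have "distr (density lborel f) borel T = density lborel f"
  proof (rule measure_eqI)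
    fix A assume "A \<in> sets (distr (density lborel f) borel T)"
    then have [measurable]: "A \<in> sets borel" by simp
    have "emeasure (distr (density lborel f) borel T) A = (\<integral>\<^sup>+ y. f (T y) * indicator A (T y) \<partial>lborel)"
      using measurable_sets[OF T, of A]
      by (subst emeasure_distr, simp, simp, subst emeasure_density) (auto simp: fT indicator_def)
    also have "\<dots> = (\<integral>\<^sup>+ y. f y * indicator A y \<partial>distr lborel borel T)"
      by (subst nn_integral_distr) auto
    also have "\<dots> = emeasure (density lborel f) A"
      by (subst emeasure_density) (auto simp: T_lborel)
    finally show "emeasure (distr (density lborel f) borel T) A = emeasure (density lborel f) A" .
  qed simp
  moreover have "distr M borel Y = density lborel f"
    using Y unfolding distributed_def f_def by (simp cong: distr_cong)
  ultimately have "distr M borel (\<lambda>\<omega>. T (Y \<omega>)) = distr M borel Y"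
    by (metis (no_types, lifting) T \<open>Y \<in> borel_measurable M\<close> comp_def distr_cong distr_distr)
  then have "distr (distr M borel (\<lambda>\<omega>. T (Y \<omega>))) borel (\<lambda>y. y - \<mu>) = distr (distr M borel Y) borel (\<lambda>y. y - \<mu>)"
    by simp
  then show ?thesis by (simp add: distr_distr comp_def T_def)
qed

lemma distr_elliptical_projection:
  assumes S: "pos_def S" and Y: "distributed M lborel Y (\<lambda>y. ennreal (elliptical_density \<mu> S g y))"
    and uv: "u \<bullet> (S *v u) = v \<bullet> (S *v v)"
  shows "distr M borel (\<lambda>\<omega>. u \<bullet> (Y \<omega> - \<mu>)) = distr M borel (\<lambda>\<omega>. v \<bullet> (Y \<omega> - \<mu>))"
proof (cases "u = v")
  case False
  have [measurable]: "Y \<in> borel_measurable M" using Y by (auto simp: distributed_def)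
  have [measurable]: "scatter_reflection S w \<in> borel_measurable borel" for w
    using linear_scatter_reflection linear_conv_bounded_linear linear_continuous_on borel_measurable_continuous_onI by blast
  have "distr M borel (\<lambda>\<omega>. v \<bullet> (Y \<omega> - \<mu>)) =
      distr (distr M borel (\<lambda>\<omega>. scatter_reflection S (u - v) (Y \<omega> - \<mu>))) borel (\<lambda>x. u \<bullet> x)"
    by (simp add: distr_distr comp_def inner_scatter_reflection_diff[OF S uv False])
  also have "\<dots> = distr M borel (\<lambda>\<omega>. u \<bullet> (Y \<omega> - \<mu>))"
    using False by (subst distr_elliptical_scatter_reflection[OF S Y]) (simp_all add: distr_distr comp_def)
  finally show ?thesis by simp
qed simp

section \<open>Fourth moments of elliptical distributions\<close>

lemma integrable_power4_add:
  fixes f g :: "'a \<Rightarrow> real"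
  assumes [measurable]: "f \<in> borel_measurable M" "g \<in> borel_measurable M"
    and "integrable M (\<lambda>x. f x ^ 4)" "integrable M (\<lambda>x. g x ^ 4)"
  shows "integrable M (\<lambda>x. (f x + g x) ^ 4)"
proof (rule Bochner_Integration.integrable_bound)
  show "integrable M (\<lambda>x. 8 * (f x ^ 4 + g x ^ 4))" using assms by auto
  have sq: "(x + y)\<^sup>2 \<le> 2 * (x\<^sup>2 + y\<^sup>2)" for x y :: real
    using zero_le_power2[of "x - y"] by (simp add: power2_eq_square algebra_simps)
  \<comment> \<open>The elementary bound \<open>sq\<close> is used twice, first for
    \<open>x, y\<close> and then for their squares.\<close>
  have "(x + y) ^ 4 \<le> 8 * (x ^ 4 + y ^ 4)" for x y :: real
  proof -
    have "((x + y)\<^sup>2)\<^sup>2 \<le> (2 * (x\<^sup>2 + y\<^sup>2))\<^sup>2" by (rule power_mono[OF sq]) simp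
    also have "\<dots> \<le> 4 * (2 * ((x\<^sup>2)\<^sup>2 + (y\<^sup>2)\<^sup>2))" unfolding power_mult_distrib using sq[of "x\<^sup>2" "y\<^sup>2"] by simp
    finally show ?thesis by (simp add: power_mult[symmetric])
  qed
  then show "AE x in M. norm ((f x + g x) ^ 4) \<le> norm (8 * (f x ^ 4 + g x ^ 4))"
    by (auto simp: abs_mult)
qed measurable

lemma integrable_power4_inner:
  fixes X :: "'a \<Rightarrow> real^'d"
  assumes [measurable]: "X \<in> borel_measurable M" and int: "\<And>j. integrable M (\<lambda>\<omega>. (X \<omega> $ j) ^ 4)"
  shows "integrable M (\<lambda>\<omega>. (u \<bullet> X \<omega>) ^ 4)"
proof -
  have [measurable]: "(\<lambda>\<omega>. X \<omega> $ j) \<in> borel_measurable M" for j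
    by (rule borel_measurable_continuous_on[OF _ assms(1)]) (intro continuous_intros)
  have "integrable M (\<lambda>\<omega>. (\<Sum>j\<in>A. u $ j * X \<omega> $ j) ^ 4)" if "finite A" for A
    using that
  proof (induction A)
    case (insert j A)
    have "integrable M (\<lambda>\<omega>. (u $ j * X \<omega> $ j + (\<Sum>j\<in>A. u $ j * X \<omega> $ j)) ^ 4)"
      by (intro integrable_power4_add insert.IH) (use int in \<open>simp_all add: power_mult_distrib\<close>)
    with insert show ?case by simp
  qed simp
  then show ?thesis by (simp add: inner_vec_def)
qed

lemma borel_measurable_vec:
  fixes f :: "'a \<Rightarrow> real^'n"
  assumes "\<And>i. (\<lambda>x. f x $ i) \<in> borel_measurable M"
  shows "f \<in> borel_measurable M"
  unfolding borel_measurable_euclidean_space[of f] using assms by (auto simp: Basis_vec_def inner_axis)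

text \<open>The form in which the matrix is later recognised as a covariance matrix. Column
  \<open>(c, e)\<close> of \<open>kron S S\<close> is \<open>vec_mat\<close> of the rank-one matrix
  \<open>A\<close>, and the commutation matrix transposes it.\<close>

lemma limit_mat_entry:
  assumes "pos_def S"
  shows "limit_mat \<kappa> S $ (a, b) $ (c, e) =
    (1 + \<kappa>) * (S $ a $ c * S $ b $ e + S $ a $ e * S $ b $ c) + \<kappa> * (S $ a $ b * S $ c $ e)"
proof -
  define A :: "real^'a^'a" where "A = (\<chi> i j. S $ i $ e * S $ j $ c)"
  have col: "column (c, e) (kron S S) = vec_mat A"
    by (simp add: vec_eq_iff column_def kron_def vec_mat_def A_def mult.commute)
  have add: "(mat 1 + commutation_mat) ** Z = Z + commutation_mat ** Z" for Z :: "real^('a \<times> 'a)^('a \<times> 'a)"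
    using matrix_mul_lid[of Z]
    by (simp add: vec_eq_iff matrix_matrix_mult_def distrib_right sum.distrib)
  from col have "column (c, e) (commutation_mat ** kron S S) = vec_mat (transpose A)"
    by (metis commutation_mat_vec_mat matrix_vector_mul_assoc matrix_vector_mult_basis)
  then have "(commutation_mat ** kron S S) $ (a, b) $ (c, e) = S $ a $ e * S $ b $ c"
    by (simp add: vec_eq_iff column_def vec_mat_def A_def transpose_def)
  then show ?thesis
    using pos_def_sym_entry[OF assms, of b a] pos_def_sym_entry[OF assms, of e c]
    by (simp add: limit_mat_def add outer_def vec_mat_def) (simp add: kron_def)
qed

text \<open>The right-hand side of polarization when fourth moments are squares of a quadratic form:
  what survives are the three pairings of four indices. Opposite signs of \<open>x, y, z\<close>
  leave \<open>l, m, n\<close> unchanged, so the squares are paired accordingly and each difference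
  factorizes.\<close>

lemma alternating_sum_of_squares:
  fixes A x y z l m n :: real
  shows "(A + 2 * (x + y + z + l + m + n))\<^sup>2 - (A + 2 * (x + y - z + l - m - n))\<^sup>2 - (A + 2 * (x - y + z - l + m - n))\<^sup>2
    - (A + 2 * (- x + y + z - l - m + n))\<^sup>2 + (A + 2 * (x - y - z - l - m + n))\<^sup>2 + (A + 2 * (- x + y - z - l + m - n))\<^sup>2
    + (A + 2 * (- x - y + z + l - m - n))\<^sup>2 - (A + 2 * (- x - y - z + l + m + n))\<^sup>2 = 64 * (x * n + y * m + z * l)"
proof -
  have *: "p\<^sup>2 - q\<^sup>2 = (p - q) * (p + q)" for p q :: real by (simp add: power2_eq_square algebra_simps)
  have "(A + 2 * (x + y + z + l + m + n))\<^sup>2 - (A + 2 * (- x - y - z + l + m + n))\<^sup>2 = 8 * (x + y + z) * (A + 2 * (l + m + n))"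
    unfolding * by (simp add: algebra_simps)
  moreover have "(A + 2 * (x + y - z + l - m - n))\<^sup>2 - (A + 2 * (- x - y + z + l - m - n))\<^sup>2 = 8 * (x + y - z) * (A + 2 * (l - m - n))"
    unfolding * by (simp add: algebra_simps)
  moreover have "(A + 2 * (x - y + z - l + m - n))\<^sup>2 - (A + 2 * (- x + y - z - l + m - n))\<^sup>2 = 8 * (x - y + z) * (A + 2 * (- l + m - n))"
    unfolding * by (simp add: algebra_simps)
  moreover have "(A + 2 * (- x + y + z - l - m + n))\<^sup>2 - (A + 2 * (x - y - z - l - m + n))\<^sup>2 = 8 * (- x + y + z) * (A + 2 * (- l - m + n))"
    unfolding * by (simp add: algebra_simps)
  moreover have "8 * (x + y + z) * (A + 2 * (l + m + n)) - 8 * (x + y - z) * (A + 2 * (l - m - n))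
     - 8 * (x - y + z) * (A + 2 * (- l + m - n)) - 8 * (- x + y + z) * (A + 2 * (- l - m + n)) = 64 * (x * n + y * m + z * l)"
    by (simp add: algebra_simps)
  ultimately show ?thesis by linarith
qed

text \<open>Pairing \<open>w + s\<close> with \<open>w - s\<close> leaves
  \<open>8 w (w^2 s + s^3)\<close>. Over the four choices of \<open>s\<close> the linear terms
  cancel and the cubes give \<open>24 x y z\<close>; hence the constant 192 = 8 * 24.\<close>

lemma polarization_power4:
  fixes w x y z :: real
  shows "192 * (w * x * y * z) = (w + x + y + z) ^ 4 - (w + x + y - z) ^ 4 - (w + x - y + z) ^ 4 - (w - x + y + z) ^ 4
    + (w + x - y - z) ^ 4 + (w - x + y - z) ^ 4 + (w - x - y + z) ^ 4 - (w - x - y - z) ^ 4"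
proof -
  have diff: "a ^ 4 - b ^ 4 = 8 * w * (w * w * s + s ^ 3)" if "a = w + s" "b = w - s" for a b s
    unfolding that by (simp add: power4_eq_xxxx power3_eq_cube algebra_simps)
  have "(x + y + z) ^ 3 - (x + y - z) ^ 3 - (x - y + z) ^ 3 - (- x + y + z) ^ 3 = 24 * (x * y * z)"
    by (simp add: power3_eq_cube algebra_simps)
  then have "192 * (w * x * y * z) = 8 * w * (w * w * (x + y + z) + (x + y + z) ^ 3)
      - 8 * w * (w * w * (x + y - z) + (x + y - z) ^ 3) - 8 * w * (w * w * (x - y + z) + (x - y + z) ^ 3)
      - 8 * w * (w * w * (- x + y + z) + (- x + y + z) ^ 3)"
    by (simp add: algebra_simps)
  moreover have "(w + x + y + z) ^ 4 - (w - x - y - z) ^ 4 = 8 * w * (w * w * (x + y + z) + (x + y + z) ^ 3)"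
    by (rule diff) simp_all
  moreover have "(w + x + y - z) ^ 4 - (w - x - y + z) ^ 4 = 8 * w * (w * w * (x + y - z) + (x + y - z) ^ 3)"
    by (rule diff) simp_all
  moreover have "(w + x - y + z) ^ 4 - (w - x + y - z) ^ 4 = 8 * w * (w * w * (x - y + z) + (x - y + z) ^ 3)"
    by (rule diff) simp_all
  moreover have "(w - x + y + z) ^ 4 - (w + x - y - z) ^ 4 = 8 * w * (w * w * (- x + y + z) + (- x + y + z) ^ 3)"
    by (rule diff) simp_all
  ultimately show ?thesis by linarith
qed

text \<open>Rescaling \<open>S\<close> and \<open>g\<close> together can give the same law; equating
  the scatter matrix with the covariance matrix fixes this scale. Fourth moments give the outer
  product of the centred vector a finite variance.\<close>

locale elliptical_vector = prob_space M for M :: "'a measure" +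
  fixes Y :: "'a \<Rightarrow> real^'d" and \<mu> S g
  assumes S: "pos_def S"
    and Y: "distributed M lborel Y (\<lambda>y. ennreal (elliptical_density \<mu> S g y))"
    and fourth_moment: "\<And>j. integrable M (\<lambda>\<omega>. (Y \<omega> $ j - \<mu> $ j) ^ 4)"
    and covariance: "covariance_mat M Y \<mu> = S"
begin

definition X where "X \<omega> = Y \<omega> - \<mu>"

lemma X_measurable[measurable]: "X \<in> borel_measurable M"
  using Y unfolding X_def[abs_def] by (auto simp: distributed_def)

lemma X_component_measurable[measurable]: "(\<lambda>\<omega>. X \<omega> $ j) \<in> borel_measurable M"
  by (rule borel_measurable_continuous_on[OF _ X_measurable]) (intro continuous_intros)

lemma integrable_inner_X_power4: "integrable M (\<lambda>\<omega>. (u \<bullet> X \<omega>) ^ 4)"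
  using fourth_moment by (intro integrable_power4_inner X_measurable) (simp add: X_def)

lemma integrable_inner_X_power2: "integrable M (\<lambda>\<omega>. (u \<bullet> X \<omega>)\<^sup>2)"
  using integrable_inner_X_power4[of u]
  by - (rule square_integrable_imp_integrable, simp_all add: power_mult[symmetric])

lemma integrable_inner_X: "integrable M (\<lambda>\<omega>. u \<bullet> X \<omega>)"
  by (rule square_integrable_imp_integrable[OF _ integrable_inner_X_power2]) simp

lemma distr_inner_X:
  "u \<bullet> (S *v u) = v \<bullet> (S *v v) \<Longrightarrow> distr M borel (\<lambda>\<omega>. u \<bullet> X \<omega>) = distr M borel (\<lambda>\<omega>. v \<bullet> X \<omega>)"
  unfolding X_def by (rule distr_elliptical_projection[OF S Y])

lemma expectation_inner_X_cong:
  assumes "u \<bullet> (S *v u) = v \<bullet> (S *v v)" and [measurable]: "h \<in> borel_measurable borel"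
  shows "expectation (\<lambda>\<omega>. h (u \<bullet> X \<omega>)) = (expectation (\<lambda>\<omega>. h (v \<bullet> X \<omega>)) :: real)"
proof -
  have "expectation (\<lambda>\<omega>. h (w \<bullet> X \<omega>)) = integral\<^sup>L (distr M borel (\<lambda>\<omega>. w \<bullet> X \<omega>)) h" for w
    by (subst integral_distr) auto
  then show ?thesis by (simp add: distr_inner_X[OF assms(1)])
qed

text \<open>The functionals \<open>u\<close> and \<open>- u\<close> have the same quadratic form, so
  the law is symmetric and \<open>\<mu>\<close> is the mean.\<close>

lemma expectation_inner_X: "expectation (\<lambda>\<omega>. u \<bullet> X \<omega>) = 0"
proof -
  have "expectation (\<lambda>\<omega>. u \<bullet> X \<omega>) = expectation (\<lambda>\<omega>. (- u) \<bullet> X \<omega>)"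
    by (rule expectation_inner_X_cong[where h="\<lambda>x. x"])
      (simp_all add: linear_neg[OF matrix_vector_mul_linear])
  then show ?thesis by simp
qed

lemma expectation_X_mult: "expectation (\<lambda>\<omega>. X \<omega> $ i * X \<omega> $ j) = S $ i $ j"
  using covariance by (simp add: covariance_mat_def X_def vec_eq_iff)

text \<open>A multiple of the coordinate functional \<open>i\<close> has the same quadratic form as
  \<open>u\<close>, hence the same law, and its fourth moment defines the kurtosis parameter. As
  \<open>i\<close> is arbitrary, that parameter does not depend on the component.\<close>

lemma expectation_inner_X_power4:
  "expectation (\<lambda>\<omega>. (u \<bullet> X \<omega>) ^ 4) = 3 * (1 + kurtosis_param M Y \<mu> S i) * (u \<bullet> (S *v u))\<^sup>2"
proof -
  have Sii: "0 < S $ i $ i" by (rule pos_def_diag_pos[OF S])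
  \<comment> \<open>The scale at which \<open>t *\<^sub>R axis i 1\<close> matches the quadratic
    form of \<open>u\<close>.\<close>
  define t where "t = sqrt (u \<bullet> (S *v u) / S $ i $ i)"
  have "0 \<le> u \<bullet> (S *v u)" using S by (cases "u = 0") (auto simp: pos_def_def intro: less_imp_le)
  then have t2: "t\<^sup>2 = u \<bullet> (S *v u) / S $ i $ i" using Sii by (simp add: t_def)
  let ?v = "t *\<^sub>R axis i (1::real)"
  have "?v \<bullet> (S *v ?v) = t\<^sup>2 * S $ i $ i"
    by (simp add: linear_cmul[OF matrix_vector_mul_linear] matrix_vector_mult_basis inner_axis' column_def power2_eq_square)
  then have "expectation (\<lambda>\<omega>. (u \<bullet> X \<omega>) ^ 4) = expectation (\<lambda>\<omega>. (?v \<bullet> X \<omega>) ^ 4)"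
    using t2 Sii by (intro expectation_inner_X_cong[where h="\<lambda>x. x ^ 4"]) auto
  also have "\<dots> = t ^ 4 * expectation (\<lambda>\<omega>. (X \<omega> $ i) ^ 4)"
    by (simp add: inner_axis' power_mult_distrib)
  also have "\<dots> = (u \<bullet> (S *v u) / S $ i $ i)\<^sup>2 * expectation (\<lambda>\<omega>. (X \<omega> $ i) ^ 4)"
    by (simp add: t2[symmetric] power_mult[symmetric])
  also have "expectation (\<lambda>\<omega>. (X \<omega> $ i) ^ 4) = 3 * (1 + kurtosis_param M Y \<mu> S i) * (S $ i $ i)\<^sup>2"
    using Sii by (simp add: kurtosis_param_def X_def field_simps)
  finally show ?thesis using Sii by (simp add: power_divide)
qed

lemma X_fourth_moments:
  shows integrable_X_mult4: "integrable M (\<lambda>\<omega>. X \<omega> $ a * X \<omega> $ b * X \<omega> $ c * X \<omega> $ e)"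
    and expectation_X_mult4: "expectation (\<lambda>\<omega>. X \<omega> $ a * X \<omega> $ b * X \<omega> $ c * X \<omega> $ e) =
      (1 + kurtosis_param M Y \<mu> S i) * (S $ a $ b * S $ c $ e + S $ a $ c * S $ b $ e + S $ a $ e * S $ b $ c)"
proof -
  define K where "K = 3 * (1 + kurtosis_param M Y \<mu> S i)"
  have K3: "K / 3 = 1 + kurtosis_param M Y \<mu> S i" by (simp add: K_def field_simps)
  define u where "u p q r = axis a 1 + p *\<^sub>R axis b 1 + q *\<^sub>R axis c 1 + r *\<^sub>R axis e (1::real)" for p q r :: real
  define F where "F p q r \<omega> = (u p q r \<bullet> X \<omega>) ^ 4" for p q r \<omega>
  have F: "F p q r \<omega> = (X \<omega> $ a + p * X \<omega> $ b + q * X \<omega> $ c + r * X \<omega> $ e) ^ 4" for p q r \<omega>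
    by (simp add: F_def u_def inner_add_left inner_axis')
  have int: "integrable M (F p q r)" for p q r
    unfolding F_def[abs_def] by (rule integrable_inner_X_power4)
  have quad: "u p q r \<bullet> (S *v u p q r) = S $ a $ a + p * p * S $ b $ b + q * q * S $ c $ c + r * r * S $ e $ e +
      2 * (p * S $ a $ b + q * S $ a $ c + r * S $ a $ e + p * q * S $ b $ c + p * r * S $ b $ e + q * r * S $ c $ e)" for p q r
    by (simp add: u_def inner_add_left inner_axis' matrix_vector_right_distrib linear_cmul[OF matrix_vector_mul_linear]
      matrix_vector_mult_basis column_def pos_def_sym_entry[OF S, of b a] pos_def_sym_entry[OF S, of c a]
      pos_def_sym_entry[OF S, of e a] pos_def_sym_entry[OF S, of c b] pos_def_sym_entry[OF S, of e b]
      pos_def_sym_entry[OF S, of e c] algebra_simps)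
  have exp: "expectation (F p q r) = K * (u p q r \<bullet> (S *v u p q r))\<^sup>2" for p q r
    unfolding F_def[abs_def] K_def by (rule expectation_inner_X_power4)
  have pol: "X \<omega> $ a * X \<omega> $ b * X \<omega> $ c * X \<omega> $ e =
      1 / 192 * (F 1 1 1 \<omega> - F 1 1 (-1) \<omega> - F 1 (-1) 1 \<omega> - F (-1) 1 1 \<omega>
        + F 1 (-1) (-1) \<omega> + F (-1) 1 (-1) \<omega> + F (-1) (-1) 1 \<omega> - F (-1) (-1) (-1) \<omega>)" for \<omega>
    using polarization_power4[of "X \<omega> $ a" "X \<omega> $ b" "X \<omega> $ c" "X \<omega> $ e"] by (simp add: F)
  show "integrable M (\<lambda>\<omega>. X \<omega> $ a * X \<omega> $ b * X \<omega> $ c * X \<omega> $ e)"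
    unfolding pol using int by (intro integrable_mult_right Bochner_Integration.integrable_add Bochner_Integration.integrable_diff)
  have "expectation (\<lambda>\<omega>. X \<omega> $ a * X \<omega> $ b * X \<omega> $ c * X \<omega> $ e) =
      1 / 192 * (expectation (F 1 1 1) - expectation (F 1 1 (-1)) - expectation (F 1 (-1) 1) - expectation (F (-1) 1 1)
        + expectation (F 1 (-1) (-1)) + expectation (F (-1) 1 (-1)) + expectation (F (-1) (-1) 1) - expectation (F (-1) (-1) (-1)))"
    unfolding pol using int by simp
  also have "\<dots> = K / 3 * (S $ a $ b * S $ c $ e + S $ a $ c * S $ b $ e + S $ a $ e * S $ b $ c)"
  proof -
    define A x y z l m n where "A = S $ a $ a + S $ b $ b + S $ c $ c + S $ e $ e" and
      "x = S $ a $ b" and "y = S $ a $ c" and "z = S $ a $ e" and "l = S $ b $ c" and "m = S $ b $ e" and "n = S $ c $ e"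
    note defs = this
    have factor: "1 / 192 * (K * a1 - K * a2 - K * a3 - K * a4 + K * a5 + K * a6 + K * a7 - K * a8) =
        K / 192 * (a1 - a2 - a3 - a4 + a5 + a6 + a7 - a8)" for a1 a2 a3 a4 a5 a6 a7 a8
      unfolding right_diff_distrib[symmetric] distrib_left[symmetric] by simp
    \<comment> \<open>The squares of the signs are 1, so the diagonal entries merge into a constant
      \<open>A\<close> common to all eight sign patterns.\<close>
    have F_exp: "expectation (F p q r) = K * (A + 2 * (p * x + q * y + r * z + p * q * l + p * r * m + q * r * n))\<^sup>2"
      if "p * p = 1" "q * q = 1" "r * r = 1" for p q r
      unfolding exp quad that defs by (rule arg_cong[where f="\<lambda>t. K * t\<^sup>2"]) simp
    have F_eq: "expectation (F 1 1 1) = K * (A + 2 * (x + y + z + l + m + n))\<^sup>2"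
      "expectation (F 1 1 (-1)) = K * (A + 2 * (x + y - z + l - m - n))\<^sup>2"
      "expectation (F 1 (-1) 1) = K * (A + 2 * (x - y + z - l + m - n))\<^sup>2"
      "expectation (F (-1) 1 1) = K * (A + 2 * (- x + y + z - l - m + n))\<^sup>2"
      "expectation (F 1 (-1) (-1)) = K * (A + 2 * (x - y - z - l - m + n))\<^sup>2"
      "expectation (F (-1) 1 (-1)) = K * (A + 2 * (- x + y - z - l + m - n))\<^sup>2"
      "expectation (F (-1) (-1) 1) = K * (A + 2 * (- x - y + z + l - m - n))\<^sup>2"
      "expectation (F (-1) (-1) (-1)) = K * (A + 2 * (- x - y - z + l + m + n))\<^sup>2"
      by (simp_all add: F_exp)
    show ?thesis
      unfolding F_eq factor alternating_sum_of_squares by (simp add: defs)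
  qed
  finally show "expectation (\<lambda>\<omega>. X \<omega> $ a * X \<omega> $ b * X \<omega> $ c * X \<omega> $ e) =
      (1 + kurtosis_param M Y \<mu> S i) * (S $ a $ b * S $ c $ e + S $ a $ c * S $ b $ e + S $ a $ e * S $ b $ c)"
    by (simp only: K3)
qed

lemma integrable_X_mult: "integrable M (\<lambda>\<omega>. X \<omega> $ i * X \<omega> $ j)"
proof (rule square_integrable_imp_integrable)
  show "integrable M (\<lambda>\<omega>. (X \<omega> $ i * X \<omega> $ j)\<^sup>2)"
    using integrable_X_mult4[of i j i j] by (simp only: power2_eq_square mult.assoc)
qed simp

section \<open>Covariance of the centred outer product\<close>

definition W :: "'a \<Rightarrow> real^('d \<times> 'd)" where
  "W \<omega> = vec_mat (outer (X \<omega>) (X \<omega>) - S)"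

lemma W_nth: "W \<omega> $ p = X \<omega> $ snd p * X \<omega> $ fst p - S $ snd p $ fst p"
  by (simp add: W_def vec_mat_def outer_def)

text \<open>Subtracting the product of the means from the fourth moment lowers the coefficient of
  one of the three pairings from \<open>1 + \<kappa>\<close> to \<open>\<kappa>\<close>. This is the
  rank-one summand of \<open>limit_mat\<close>.\<close>

lemma W_moments:
  shows integrable_W: "integrable M (\<lambda>\<omega>. W \<omega> $ p)"
    and expectation_W: "expectation (\<lambda>\<omega>. W \<omega> $ p) = 0"
    and integrable_W_mult: "integrable M (\<lambda>\<omega>. W \<omega> $ p * W \<omega> $ r)"
    and expectation_W_mult: "expectation (\<lambda>\<omega>. W \<omega> $ p * W \<omega> $ r) = limit_mat (kurtosis_param M Y \<mu> S i) S $ p $ r"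
proof -
  show "integrable M (\<lambda>\<omega>. W \<omega> $ p)" "expectation (\<lambda>\<omega>. W \<omega> $ p) = 0"
    using integrable_X_mult by (simp_all add: W_nth expectation_X_mult prob_space)
  have W2: "W \<omega> $ p * W \<omega> $ r = X \<omega> $ snd p * X \<omega> $ fst p * X \<omega> $ snd r * X \<omega> $ fst r
      - S $ snd r $ fst r * (X \<omega> $ snd p * X \<omega> $ fst p) - S $ snd p $ fst p * (X \<omega> $ snd r * X \<omega> $ fst r)
      + S $ snd p $ fst p * S $ snd r $ fst r" for \<omega>
    by (simp add: W_nth algebra_simps)
  show "integrable M (\<lambda>\<omega>. W \<omega> $ p * W \<omega> $ r)"
    unfolding W2 using integrable_X_mult integrable_X_mult4 by auto
  have "expectation (\<lambda>\<omega>. W \<omega> $ p * W \<omega> $ r) =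
      expectation (\<lambda>\<omega>. X \<omega> $ snd p * X \<omega> $ fst p * X \<omega> $ snd r * X \<omega> $ fst r) - S $ snd p $ fst p * S $ snd r $ fst r"
    unfolding W2 using integrable_X_mult integrable_X_mult4 by (simp add: expectation_X_mult prob_space)
  also have "\<dots> = limit_mat (kurtosis_param M Y \<mu> S i) S $ p $ r"
    using limit_mat_entry[OF S, of _ "fst p" "snd p" "fst r" "snd r"]
      pos_def_sym_entry[OF S, of "snd p" "fst p"] pos_def_sym_entry[OF S, of "snd r" "fst r"]
      pos_def_sym_entry[OF S, of "snd p" "fst r"] pos_def_sym_entry[OF S, of "snd r" "fst p"]
    unfolding expectation_X_mult4[where i=i] by (simp add: algebra_simps)
  finally show "expectation (\<lambda>\<omega>. W \<omega> $ p * W \<omega> $ r) = limit_mat (kurtosis_param M Y \<mu> S i) S $ p $ r" .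
qed

lemma inner_W_moments:
  shows integrable_inner_W: "integrable M (\<lambda>\<omega>. a \<bullet> W \<omega>)"
    and expectation_inner_W: "expectation (\<lambda>\<omega>. a \<bullet> W \<omega>) = 0"
    and integrable_inner_W_power2: "integrable M (\<lambda>\<omega>. (a \<bullet> W \<omega>)\<^sup>2)"
    and expectation_inner_W_power2:
      "expectation (\<lambda>\<omega>. (a \<bullet> W \<omega>)\<^sup>2) = a \<bullet> (limit_mat (kurtosis_param M Y \<mu> S i) S *v a)"
proof -
  show "integrable M (\<lambda>\<omega>. a \<bullet> W \<omega>)" "expectation (\<lambda>\<omega>. a \<bullet> W \<omega>) = 0"
    using integrable_W by (simp_all add: inner_vec_def expectation_W)
  have sq: "(a \<bullet> W \<omega>)\<^sup>2 = (\<Sum>p\<in>UNIV. \<Sum>r\<in>UNIV. a $ p * a $ r * (W \<omega> $ p * W \<omega> $ r))" for \<omega>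
    by (simp add: inner_vec_def power2_eq_square sum_product mult_ac)
  show "integrable M (\<lambda>\<omega>. (a \<bullet> W \<omega>)\<^sup>2)"
    unfolding sq using integrable_W_mult by auto
  show "expectation (\<lambda>\<omega>. (a \<bullet> W \<omega>)\<^sup>2) = a \<bullet> (limit_mat (kurtosis_param M Y \<mu> S i) S *v a)"
    unfolding sq using integrable_W_mult
    by (simp add: expectation_W_mult[where i=i] inner_vec_def matrix_vector_mult_def sum_distrib_left mult_ac)
qed

text \<open>This entry is the variance of the square of component \<open>j\<close>. If it vanished,
  that component would take only two values almost surely, which a law with a density excludes. It
  rules out a zero limit matrix and thereby atoms of the limit law.\<close>

lemma limit_mat_diag_pos: "0 < limit_mat (kurtosis_param M Y \<mu> S i) S $ (j, j) $ (j, j)"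
proof (rule ccontr)
  let ?W = "\<lambda>\<omega>. W \<omega> $ (j, j) * W \<omega> $ (j, j)"
  assume "\<not> ?thesis"
  moreover have "0 \<le> expectation ?W" by (rule integral_nonneg_AE) simp
  ultimately have "expectation ?W = 0" using expectation_W_mult[of "(j, j)" "(j, j)" i] by simp
  then have "AE \<omega> in M. ?W \<omega> = 0"
    using integral_nonneg_eq_0_iff_AE[OF integrable_W_mult] by simp
  then have sqrt_cases: "AE \<omega> in M. Y \<omega> $ j = \<mu> $ j + sqrt (S $ j $ j) \<or> Y \<omega> $ j = \<mu> $ j - sqrt (S $ j $ j)"
  proof (rule eventually_mono)
    fix \<omega> assume "?W \<omega> = 0"
    then have "(X \<omega> $ j)\<^sup>2 = S $ j $ j" by (simp add: W_nth power2_eq_square)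
    then have "X \<omega> $ j = sqrt (S $ j $ j) \<or> X \<omega> $ j = - sqrt (S $ j $ j)"
      by (metis abs_if minus_equation_iff real_sqrt_abs)
    then show "Y \<omega> $ j = \<mu> $ j + sqrt (S $ j $ j) \<or> Y \<omega> $ j = \<mu> $ j - sqrt (S $ j $ j)"
      by (auto simp: X_def)
  qed
  have nonatomic: "AE \<omega> in M. Y \<omega> $ j \<noteq> c" for c
  proof -
    have "{y :: real^'d. y $ j = c} \<in> null_sets lebesgue"
      using negligible_hyperplane[of "axis j (1::real)" c] by (simp add: negligible_iff_null_sets axis_eq_0_iff inner_axis')
    moreover have meas: "{y :: real^'d. y $ j = c} \<in> sets borel"
      by (intro borel_closed closed_Collect_eq continuous_intros)
    ultimately have "{y :: real^'d. y $ j = c} \<in> null_sets lborel"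
      by (simp add: null_sets_completion_iff)
    then have "AE y in lborel. (y :: real^'d) $ j \<noteq> c" by (rule AE_I') auto
    then show ?thesis
      using distributed_AE2[OF Y, of "\<lambda>y. y $ j \<noteq> c"] by (auto elim!: eventually_mono)
  qed
  from sqrt_cases nonatomic[of "\<mu> $ j + sqrt (S $ j $ j)"] nonatomic[of "\<mu> $ j - sqrt (S $ j $ j)"]
  have "AE \<omega> in M. False" by eventually_elim auto
  then show False by simp
qed

end

section \<open>Sums of independent random variables\<close>

text \<open>Reindexing moves the sample from \<open>{1..}\<close> to all natural numbers through
  \<open>Suc\<close>, the index set of the central limit theorem.\<close>

lemma (in prob_space) indep_vars_comp_inj:
  assumes ind: "indep_vars M' X (f ` I)" and f: "inj_on f I"
  shows "indep_vars (\<lambda>i. M' (f i)) (\<lambda>i. X (f i)) I"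
  unfolding indep_vars_def2
proof (intro conjI ballI)
  show "random_variable (M' (f i)) (X (f i))" if "i \<in> I" for i
    using ind that unfolding indep_vars_def2 by blast
  let ?F = "\<lambda>i. {X i -` A \<inter> space M |A. A \<in> sets (M' i)}"
  have F: "indep_sets ?F (f ` I)" using ind unfolding indep_vars_def2 by blast
  show "indep_sets (\<lambda>i. ?F (f i)) I"
  proof (rule indep_setsI)
    show "?F (f i) \<subseteq> events" if "i \<in> I" for i
      using F that unfolding indep_sets_def by blast
    fix A J assume J: "J \<noteq> {}" "J \<subseteq> I" "finite J" "\<forall>j\<in>J. A j \<in> ?F (f j)"
    have inj: "inj_on f J" using f J(2) by (rule inj_on_subset)
    define B where "B k = A (the_inv_into J f k)" for k
    have B: "B (f j) = A j" if "j \<in> J" for j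
      using the_inv_into_f_f[OF inj that] by (simp add: B_def)
    have "prob (\<Inter>k\<in>f ` J. B k) = (\<Prod>k\<in>f ` J. prob (B k))"
      by (rule indep_setsD[OF F]) (use J B in auto)
    then show "prob (\<Inter>j\<in>J. A j) = (\<Prod>j\<in>J. prob (A j))"
      by (simp add: prod.reindex[OF inj] B)
  qed
qed

lemma (in prob_space) expectation_sum_power2_indep:
  fixes Z :: "nat \<Rightarrow> 'a \<Rightarrow> real"
  assumes ind: "indep_vars (\<lambda>_. borel) Z UNIV"
    and int: "\<And>k. integrable M (Z k)" and mean: "\<And>k. expectation (Z k) = 0"
    and int2: "\<And>k. integrable M (\<lambda>\<omega>. (Z k \<omega>)\<^sup>2)" and var: "\<And>k. expectation (\<lambda>\<omega>. (Z k \<omega>)\<^sup>2) = v"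
  shows "integrable M (\<lambda>\<omega>. (\<Sum>k<n. Z k \<omega>)\<^sup>2)" "expectation (\<lambda>\<omega>. (\<Sum>k<n. Z k \<omega>)\<^sup>2) = real n * v"
proof -
  have mult: "integrable M (\<lambda>\<omega>. Z i \<omega> * Z j \<omega>)" "expectation (\<lambda>\<omega>. Z i \<omega> * Z j \<omega>) = (if i = j then v else 0)" for i j
  proof -
    have "integrable M (\<lambda>\<omega>. Z i \<omega> * Z j \<omega>) \<and> expectation (\<lambda>\<omega>. Z i \<omega> * Z j \<omega>) = 0" if "i \<noteq> j"
    proof -
      have ind': "indep_vars (\<lambda>_. borel) Z {i, j}" by (rule indep_vars_subset[OF ind]) simp
      show ?thesis
        using indep_vars_integrable[OF _ ind' int] indep_vars_lebesgue_integral[OF _ ind' int] that mean by simp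
    qed
    then show "integrable M (\<lambda>\<omega>. Z i \<omega> * Z j \<omega>)" "expectation (\<lambda>\<omega>. Z i \<omega> * Z j \<omega>) = (if i = j then v else 0)"
      using int2[of i] var[of i] by (cases "i = j"; simp add: power2_eq_square)+
  qed
  have sq: "(\<Sum>k<n. Z k \<omega>)\<^sup>2 = (\<Sum>i<n. \<Sum>j<n. Z i \<omega> * Z j \<omega>)" for \<omega>
    by (simp add: power2_eq_square sum_product)
  show "integrable M (\<lambda>\<omega>. (\<Sum>k<n. Z k \<omega>)\<^sup>2)" unfolding sq using mult by auto
  show "expectation (\<lambda>\<omega>. (\<Sum>k<n. Z k \<omega>)\<^sup>2) = real n * v"
    unfolding sq using mult by simp
qed

text \<open>Zero variance must be allowed: directions that are antisymmetric as matrices annihilate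
  every symmetric outer product. There the summands vanish almost surely; otherwise the central
  limit theorem applies.\<close>

lemma (in prob_space) iid_char_tendsto_normal:
  fixes Z :: "nat \<Rightarrow> 'a \<Rightarrow> real"
  assumes ind: "indep_vars (\<lambda>_. borel) Z UNIV" and distr: "\<And>k. distr M borel (Z k) = distr M borel (Z 0)"
    and mean: "\<And>k. expectation (Z k) = 0"
    and int2: "\<And>k. integrable M (\<lambda>\<omega>. (Z k \<omega>)\<^sup>2)" and var: "\<And>k. expectation (\<lambda>\<omega>. (Z k \<omega>)\<^sup>2) = v"
  shows "(\<lambda>n. CLINT \<omega>|M. iexp ((\<Sum>k<n. Z k \<omega>) / sqrt (real n))) \<longlonglongrightarrow> exp (- v / 2)"
proof -
  have [measurable]: "Z k \<in> borel_measurable M" for k using ind by (auto simp: indep_vars_def2)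
  have "0 \<le> v" using var[of 0] by (auto intro: integral_nonneg_AE)
  show ?thesis
  proof (cases "v = 0")
    case True
    have "AE \<omega> in M. Z k \<omega> = 0" for k
      using integral_nonneg_eq_0_iff_AE[OF int2[of k]] var[of k] True by simp
    then have "AE \<omega> in M. \<forall>k. Z k \<omega> = 0" by (simp add: AE_all_countable)
    then have "(CLINT \<omega>|M. iexp ((\<Sum>k<n. Z k \<omega>) / sqrt (real n))) = (CLINT \<omega>|M. 1)" for n
      by (intro integral_cong_AE) auto
    then show ?thesis using True by (simp add: prob_space)
  next
    case False
    define \<sigma> where "\<sigma> = sqrt v"
    have \<sigma>: "\<sigma> > 0" "\<sigma>\<^sup>2 = v" using False \<open>0 \<le> v\<close> by (auto simp: \<sigma>_def)
    have "variance (Z k) = \<sigma>\<^sup>2" for k using mean[of k] var[of k] \<sigma>(2) by simp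
    from central_limit_theorem_zero_mean[OF ind mean \<sigma>(1) int2 this distr]
    have "weak_conv_m (\<lambda>n. distr M borel (\<lambda>\<omega>. (\<Sum>k<n. Z k \<omega>) / sqrt (real n * \<sigma>\<^sup>2))) std_normal_distribution" .
    \<comment> \<open>Evaluation at \<open>\<sigma>\<close> undoes the division by the standard
      deviation in the central limit theorem.\<close>
    then have "(\<lambda>n. char (distr M borel (\<lambda>\<omega>. (\<Sum>k<n. Z k \<omega>) / sqrt (real n * \<sigma>\<^sup>2))) \<sigma>) \<longlonglongrightarrow> char std_normal_distribution \<sigma>"
      by (intro levy_continuity1 real_dist_normal_dist real_distribution_distr) auto
    moreover have "char (distr M borel (\<lambda>\<omega>. (\<Sum>k<n. Z k \<omega>) / sqrt (real n * \<sigma>\<^sup>2))) \<sigma> =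
        (CLINT \<omega>|M. iexp ((\<Sum>k<n. Z k \<omega>) / sqrt (real n)))" for n
    proof -
      have "\<sigma> * ((\<Sum>k<n. Z k \<omega>) / sqrt (real n * \<sigma>\<^sup>2)) = (\<Sum>k<n. Z k \<omega>) / sqrt (real n)" for \<omega>
        using \<sigma>(1) by (simp add: real_sqrt_mult)
      then show ?thesis unfolding char_def by (subst integral_distr) (simp_all only:, measurable)
    qed
    ultimately show ?thesis by (simp add: char_std_normal_distribution \<sigma>(2))
  qed
qed

text \<open>The derivative is bounded by 1 since
  \<open>2 \<bar>x\<bar> \<le> 1 + x^2 \<le> exp (x^2)\<close>. It turns a small error in a norm
  into a small error in a Laplace transform.\<close>

lemma exp_minus_square_Lipschitz: "\<bar>exp (- a\<^sup>2) - exp (- b\<^sup>2)\<bar> \<le> \<bar>a - b\<bar>" for a b :: real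
proof -
  have "norm (exp (- a\<^sup>2) - exp (- b\<^sup>2)) \<le> 1 * norm (a - b)"
  proof (rule field_differentiable_bound[where S = UNIV and f' = "\<lambda>x. - (2 * x * exp (- x\<^sup>2))"])
    show "((\<lambda>x. exp (- x\<^sup>2)) has_real_derivative - (2 * x * exp (- x\<^sup>2))) (at x within UNIV)" for x
      by (auto intro!: derivative_eq_intros)
    show "norm (- (2 * x * exp (- x\<^sup>2))) \<le> 1" for x :: real
    proof -
      have "0 \<le> (\<bar>x\<bar> - 1)\<^sup>2" by simp
      then have "2 * \<bar>x\<bar> \<le> 1 + x\<^sup>2" by (simp add: power2_diff)
      also have "\<dots> \<le> exp (x\<^sup>2)" by (rule exp_ge_add_one_self)
      finally show ?thesis by (simp add: abs_mult exp_minus field_simps)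
    qed
  qed auto
  then show ?thesis by simp
qed

section \<open>The sample covariance of an elliptical sample\<close>

lemma norm_vec_mat_outer: "norm (vec_mat (outer x x)) = x \<bullet> x"
proof -
  have "(norm (vec_mat (outer x x)))\<^sup>2 = (x \<bullet> x)\<^sup>2"
    unfolding power2_norm_eq_inner
    by (simp add: inner_vec_def vec_mat_def outer_def sum_UNIV_pair sum_product power2_eq_square mult_ac)
  then show ?thesis by (simp add: power2_eq_iff_nonneg)
qed

lemma transpose_limit_mat:
  assumes "pos_def S"
  shows "transpose (limit_mat \<kappa> S) = limit_mat \<kappa> S"
proof -
  have "limit_mat \<kappa> S $ (c, e) $ (a, b) = limit_mat \<kappa> S $ (a, b) $ (c, e)" for a b c e
    using pos_def_sym_entry[OF assms, of c a] pos_def_sym_entry[OF assms, of e b]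
      pos_def_sym_entry[OF assms, of c b] pos_def_sym_entry[OF assms, of e a]
    by (simp add: limit_mat_entry[OF assms] mult_ac)
  then show ?thesis by (auto simp: vec_eq_iff transpose_def)
qed

text \<open>A function of an observed value rather than of the sample point, so that it applies to
  each member of the sample.\<close>

definition centered_outer :: "real^'d \<Rightarrow> real^'d^'d \<Rightarrow> real^'d \<Rightarrow> real^('d \<times> 'd)" where
  "centered_outer \<mu> S y = vec_mat (outer (y - \<mu>) (y - \<mu>) - S)"

lemma centered_outer_measurable[measurable]: "centered_outer \<mu> S \<in> borel_measurable borel"
  by (rule borel_measurable_vec, rule borel_measurable_continuous_onI)
    (auto simp: centered_outer_def vec_mat_def outer_def intro!: continuous_intros)

text \<open>Centring at the sample mean instead of \<open>\<mu>\<close> costs only a rank-one term,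
  because the deviations from \<open>\<mu>\<close> sum to \<open>n\<close> times the error of the
  mean.\<close>

lemma vec_mat_sample_cov:
  fixes y :: "nat \<Rightarrow> real^'d"
  assumes "n \<noteq> 0"
  shows "vec_mat (sample_cov n y - S0) = (1 / real n) *\<^sub>R (\<Sum>k<n. centered_outer \<mu> S (y (Suc k)))
    + vec_mat (S - S0) - vec_mat (outer (sample_mean n y - \<mu>) (sample_mean n y - \<mu>))"
proof -
  define m where "m = sample_mean n y - \<mu>"
  have m: "(\<Sum>k<n. y (Suc k) $ a - \<mu> $ a) = real n * m $ a" for a
    using assms by (simp add: m_def sample_mean_def sum.atLeast1_atMost_eq sum_subtractf field_simps)
  have "(\<Sum>k<n. (y (Suc k) $ a - \<mu> $ a - m $ a) * (y (Suc k) $ b - \<mu> $ b - m $ b)) =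
      (\<Sum>k<n. (y (Suc k) $ a - \<mu> $ a) * (y (Suc k) $ b - \<mu> $ b)) - real n * (m $ a * m $ b)" for a b
  proof -
    have "(\<Sum>k<n. (y (Suc k) $ a - \<mu> $ a - m $ a) * (y (Suc k) $ b - \<mu> $ b - m $ b)) =
        (\<Sum>k<n. (y (Suc k) $ a - \<mu> $ a) * (y (Suc k) $ b - \<mu> $ b))
        - m $ b * (\<Sum>k<n. y (Suc k) $ a - \<mu> $ a) - m $ a * (\<Sum>k<n. y (Suc k) $ b - \<mu> $ b) + real n * (m $ a * m $ b)"
      by (simp add: algebra_simps sum.distrib sum_subtractf sum_distrib_left)
    then show ?thesis unfolding m by (simp add: algebra_simps)
  qed
  then have cov: "sample_cov n y $ a $ b =
      (1 / real n) * (\<Sum>k<n. (y (Suc k) $ a - \<mu> $ a) * (y (Suc k) $ b - \<mu> $ b)) - m $ a * m $ b" for a b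
    using assms
    by (simp add: sample_cov_def outer_def sum.atLeast1_atMost_eq m_def right_diff_distrib)
  show ?thesis
    using assms
    by (simp add: vec_eq_iff centered_outer_def vec_mat_def outer_def cov m_def[symmetric] sum_subtractf right_diff_distrib)
qed

locale elliptical_iid = prob_space M for M :: "'a measure" +
  fixes Y :: "nat \<Rightarrow> 'a \<Rightarrow> real^'d" and \<mu> S g
  assumes S: "pos_def S"
    and sample: "elliptical_sample M Y \<mu> S g"
    and fourth_moment: "\<And>j. integrable M (\<lambda>\<omega>. (Y 1 \<omega> $ j - \<mu> $ j) ^ 4)"
    and covariance: "covariance_mat M (Y 1) \<mu> = S"

sublocale elliptical_iid \<subseteq> obs: elliptical_vector M "Y (Suc 0)" \<mu> S g
  using S sample fourth_moment covariance by unfold_locales (auto simp: elliptical_sample_def)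

context elliptical_iid
begin

lemma Y_measurable[measurable]: "Y (Suc k) \<in> borel_measurable M"
  using sample by (auto simp: elliptical_sample_def distributed_def)

lemma distr_Y: "distr M borel (Y (Suc k)) = distr M borel (Y (Suc 0))"
proof -
  have "distr M borel (Y (Suc k)) = density lborel (\<lambda>y. ennreal (elliptical_density \<mu> S g y))" for k
    using sample unfolding elliptical_sample_def distributed_def by (simp cong: distr_cong)
  from this[of k] this[of 0] show ?thesis by simp
qed

text \<open>Statements about any observation reduce to the first one, to which the moment
  computations for a single vector apply.\<close>

lemma iid_comp:
  fixes h :: "real^'d \<Rightarrow> real"
  assumes [measurable]: "h \<in> borel_measurable borel"
  shows "indep_vars (\<lambda>_. borel) (\<lambda>k \<omega>. h (Y (Suc k) \<omega>)) UNIV"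
    and "distr M borel (\<lambda>\<omega>. h (Y (Suc k) \<omega>)) = distr M borel (\<lambda>\<omega>. h (Y (Suc 0) \<omega>))"
    and "integrable M (\<lambda>\<omega>. h (Y (Suc k) \<omega>)) \<longleftrightarrow> integrable M (\<lambda>\<omega>. h (Y (Suc 0) \<omega>))"
    and "expectation (\<lambda>\<omega>. h (Y (Suc k) \<omega>)) = expectation (\<lambda>\<omega>. h (Y (Suc 0) \<omega>))"
proof -
  have "range Suc = {1..}" by (auto simp: image_iff) (metis Suc_le_D One_nat_def)
  then have "indep_vars (\<lambda>_. borel) (\<lambda>k. Y (Suc k)) UNIV"
    using sample indep_vars_comp_inj[of "\<lambda>_. borel" Y Suc UNIV] by (simp add: elliptical_sample_def)
  then show "indep_vars (\<lambda>_. borel) (\<lambda>k \<omega>. h (Y (Suc k) \<omega>)) UNIV"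
    by (rule indep_vars_compose2) simp
  have "Y (Suc 0) \<in> borel_measurable M" using Y_measurable[of 0] by simp
  note [measurable] = this
  have distr_h: "distr M borel (\<lambda>\<omega>. h (Y (Suc k) \<omega>)) = distr (distr M borel (Y (Suc k))) borel h" for k
    by (simp add: distr_distr comp_def)
  show "distr M borel (\<lambda>\<omega>. h (Y (Suc k) \<omega>)) = distr M borel (\<lambda>\<omega>. h (Y (Suc 0) \<omega>))"
    using distr_h[of k] distr_h[of 0] distr_Y[of k] by simp
  show "integrable M (\<lambda>\<omega>. h (Y (Suc k) \<omega>)) \<longleftrightarrow> integrable M (\<lambda>\<omega>. h (Y (Suc 0) \<omega>))"
    using integrable_distr_eq[of "Y (Suc k)" M borel h] integrable_distr_eq[of "Y (Suc 0)" M borel h] distr_Y[of k] by simp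
  show "expectation (\<lambda>\<omega>. h (Y (Suc k) \<omega>)) = expectation (\<lambda>\<omega>. h (Y (Suc 0) \<omega>))"
    using integral_distr[of "Y (Suc k)" M borel h] integral_distr[of "Y (Suc 0)" M borel h] distr_Y[of k] by simp
qed

definition mean_error :: "nat \<Rightarrow> 'a \<Rightarrow> real^'d" where
  "mean_error n \<omega> = sample_mean n (\<lambda>k. Y k \<omega>) - \<mu>"

definition W_sum :: "nat \<Rightarrow> 'a \<Rightarrow> real^('d \<times> 'd)" where
  "W_sum n \<omega> = (\<Sum>k<n. centered_outer \<mu> S (Y (Suc k) \<omega>))"

lemma W_sum_measurable[measurable]: "W_sum n \<in> borel_measurable M"
  unfolding W_sum_def[abs_def] by measurable

lemma mean_error_measurable[measurable]: "mean_error n \<in> borel_measurable M"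
  unfolding mean_error_def[abs_def] sample_mean_def One_nat_def sum.atLeast1_atMost_eq by measurable

lemma W_eq: "obs.W \<omega> = centered_outer \<mu> S (Y (Suc 0) \<omega>)"
  by (simp add: obs.W_def obs.X_def centered_outer_def)

lemma expectation_mean_error:
  assumes "n \<noteq> 0"
  shows "integrable M (\<lambda>\<omega>. mean_error n \<omega> \<bullet> mean_error n \<omega>)"
    and "expectation (\<lambda>\<omega>. mean_error n \<omega> \<bullet> mean_error n \<omega>) = (\<Sum>j\<in>UNIV. S $ j $ j) / real n"
proof -
  have comp: "integrable M (\<lambda>\<omega>. (mean_error n \<omega> $ j)\<^sup>2)" "expectation (\<lambda>\<omega>. (mean_error n \<omega> $ j)\<^sup>2) = S $ j $ j / real n" for j
  proof -
    define h where "h y = y $ j - \<mu> $ j" for y :: "real^'d"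
    have [measurable]: "h \<in> borel_measurable borel"
      unfolding h_def[abs_def] by (rule borel_measurable_continuous_onI) (intro continuous_intros)
    have h: "h (Y (Suc 0) \<omega>) = axis j 1 \<bullet> obs.X \<omega>" for \<omega> by (simp add: h_def obs.X_def inner_axis')
    have sq: "expectation (\<lambda>\<omega>. (h (Y (Suc 0) \<omega>))\<^sup>2) = S $ j $ j"
      using obs.expectation_X_mult[of j j] by (simp add: h inner_axis' power2_eq_square)
    note sum2 = expectation_sum_power2_indep[of "\<lambda>k \<omega>. h (Y (Suc k) \<omega>)" "S $ j $ j", OF iid_comp(1)]
    have eq: "(mean_error n \<omega> $ j)\<^sup>2 = (\<Sum>k<n. h (Y (Suc k) \<omega>))\<^sup>2 / (real n)\<^sup>2" for \<omega>
      using assms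
      by (simp add: mean_error_def sample_mean_def sum.atLeast1_atMost_eq h_def sum_subtractf power_divide[symmetric] diff_divide_distrib)
    have prem: "integrable M (\<lambda>\<omega>. h (Y (Suc k) \<omega>))" "expectation (\<lambda>\<omega>. h (Y (Suc k) \<omega>)) = 0"
      "integrable M (\<lambda>\<omega>. (h (Y (Suc k) \<omega>))\<^sup>2)" "expectation (\<lambda>\<omega>. (h (Y (Suc k) \<omega>))\<^sup>2) = S $ j $ j" for k
      unfolding iid_comp(3,4)[of h k, simplified] iid_comp(3,4)[of "\<lambda>y. (h y)\<^sup>2" k, simplified] sq
      unfolding h by (simp_all add: obs.integrable_inner_X obs.expectation_inner_X obs.integrable_inner_X_power2)
    show "integrable M (\<lambda>\<omega>. (mean_error n \<omega> $ j)\<^sup>2)"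
      unfolding eq by (intro integrable_divide sum2(1)) (auto simp: prem)
    show "expectation (\<lambda>\<omega>. (mean_error n \<omega> $ j)\<^sup>2) = S $ j $ j / real n"
      unfolding eq using assms by (simp add: sum2(2) prem power2_eq_square[of "real n"])
  qed
  have inner: "mean_error n \<omega> \<bullet> mean_error n \<omega> = (\<Sum>j\<in>UNIV. (mean_error n \<omega> $ j)\<^sup>2)" for \<omega>
    by (simp add: inner_vec_def power2_eq_square)
  show "integrable M (\<lambda>\<omega>. mean_error n \<omega> \<bullet> mean_error n \<omega>)"
    "expectation (\<lambda>\<omega>. mean_error n \<omega> \<bullet> mean_error n \<omega>) = (\<Sum>j\<in>UNIV. S $ j $ j) / real n"
    unfolding inner using comp by (simp_all add: sum_divide_distrib)
qed

lemma inner_W_moments: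
  shows "integrable M (\<lambda>\<omega>. a \<bullet> centered_outer \<mu> S (Y (Suc k) \<omega>))"
    and "expectation (\<lambda>\<omega>. a \<bullet> centered_outer \<mu> S (Y (Suc k) \<omega>)) = 0"
    and "integrable M (\<lambda>\<omega>. (a \<bullet> centered_outer \<mu> S (Y (Suc k) \<omega>))\<^sup>2)"
    and "expectation (\<lambda>\<omega>. (a \<bullet> centered_outer \<mu> S (Y (Suc k) \<omega>))\<^sup>2) =
      a \<bullet> (limit_mat (kurtosis_param M (Y (Suc 0)) \<mu> S i) S *v a)"
  unfolding iid_comp(3,4)[of "\<lambda>y. a \<bullet> centered_outer \<mu> S y" k, simplified]
    iid_comp(3,4)[of "\<lambda>y. (a \<bullet> centered_outer \<mu> S y)\<^sup>2" k, simplified]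
  unfolding W_eq[symmetric]
  by (simp_all add: obs.integrable_inner_W obs.expectation_inner_W obs.integrable_inner_W_power2 obs.expectation_inner_W_power2[of _ i])

text \<open>The Cramer-Wold device at the level of characteristic functions: the scalar central
  limit theorem in each direction \<open>a\<close>.\<close>

lemma W_sum_char_tendsto:
  "(\<lambda>n. CLINT \<omega>|M. iexp (a \<bullet> ((1 / sqrt (real n)) *\<^sub>R W_sum n \<omega>))) \<longlonglongrightarrow>
    exp (- (a \<bullet> (limit_mat (kurtosis_param M (Y (Suc 0)) \<mu> S i) S *v a)) / 2)"
proof -
  have "(\<lambda>n. CLINT \<omega>|M. iexp ((\<Sum>k<n. a \<bullet> centered_outer \<mu> S (Y (Suc k) \<omega>)) / sqrt (real n))) \<longlonglongrightarrow>
    exp (- (a \<bullet> (limit_mat (kurtosis_param M (Y (Suc 0)) \<mu> S i) S *v a)) / 2)"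
  proof (rule iid_char_tendsto_normal)
    show "indep_vars (\<lambda>_. borel) (\<lambda>k \<omega>. a \<bullet> centered_outer \<mu> S (Y (Suc k) \<omega>)) UNIV"
      by (rule iid_comp(1)) measurable
    show "distr M borel (\<lambda>\<omega>. a \<bullet> centered_outer \<mu> S (Y (Suc k) \<omega>)) =
        distr M borel (\<lambda>\<omega>. a \<bullet> centered_outer \<mu> S (Y (Suc 0) \<omega>))" for k
      using iid_comp(2)[of "\<lambda>y. a \<bullet> centered_outer \<mu> S y" k] by simp
  qed (rule inner_W_moments)+
  then show ?thesis by (simp add: W_sum_def inner_sum_right)
qed

lemma expectation_W_sum:
  obtains C where "\<And>n. integrable M (\<lambda>\<omega>. W_sum n \<omega> \<bullet> W_sum n \<omega>)"
    "\<And>n. expectation (\<lambda>\<omega>. W_sum n \<omega> \<bullet> W_sum n \<omega>) = real n * C"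
proof -
  \<comment> \<open>The variance formula holds with the kurtosis parameter of every component, so an
    arbitrary index may be chosen.\<close>
  define v where "v p = axis p 1 \<bullet> (limit_mat (kurtosis_param M (Y (Suc 0)) \<mu> S undefined) S *v axis p 1)" for p
  define Z where "Z p k \<omega> = axis p 1 \<bullet> centered_outer \<mu> S (Y (Suc k) \<omega>)" for p k \<omega>
  have Z: "integrable M (\<lambda>\<omega>. (\<Sum>k<n. Z p k \<omega>)\<^sup>2)" "expectation (\<lambda>\<omega>. (\<Sum>k<n. Z p k \<omega>)\<^sup>2) = real n * v p" for n p
  proof -
    have "indep_vars (\<lambda>_. borel) (Z p) UNIV"
      unfolding Z_def[abs_def] by (rule iid_comp(1)) measurable
    note * = expectation_sum_power2_indep[OF this, where v="v p", unfolded Z_def v_def, OF inner_W_moments]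
    show "integrable M (\<lambda>\<omega>. (\<Sum>k<n. Z p k \<omega>)\<^sup>2)" "expectation (\<lambda>\<omega>. (\<Sum>k<n. Z p k \<omega>)\<^sup>2) = real n * v p"
      unfolding Z_def v_def by (rule *)+
  qed
  have inner: "W_sum n \<omega> \<bullet> W_sum n \<omega> = (\<Sum>p\<in>UNIV. (\<Sum>k<n. Z p k \<omega>)\<^sup>2)" for n \<omega>
    by (simp add: W_sum_def Z_def inner_axis' inner_vec_def[of "sum _ _"] power2_eq_square)
  show thesis
    by (rule that[of "\<Sum>p\<in>UNIV. v p"]) (simp_all add: inner Z sum_distrib_left)
qed

text \<open>A decomposition into fluctuation, drift and the error from estimating the mean. The case
  \<open>n = 0\<close> holds because both sides are zero, which keeps measurability free of side
  conditions.\<close>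

lemma T_sq_eq:
  "T_sq S0 n (\<lambda>k. Y k \<omega>) = (norm ((1 / sqrt (real n)) *\<^sub>R W_sum n \<omega> + sqrt (real n) *\<^sub>R vec_mat (S - S0)
    - sqrt (real n) *\<^sub>R vec_mat (outer (mean_error n \<omega>) (mean_error n \<omega>))))\<^sup>2"
proof (cases "n = 0")
  case False
  have "sqrt (real n) * (1 / real n) = 1 / sqrt (real n)"
    using False by (simp add: field_simps)
  then show ?thesis
    unfolding T_sq_def vec_mat_sample_cov[OF False, of _ S0 \<mu> S] mean_error_def W_sum_def
    by (simp only: scaleR_diff_right scaleR_add_right scaleR_scaleR)
qed (simp add: T_sq_def)

lemma vec_mat_outer_measurable[measurable]:
  "(\<lambda>\<omega>. vec_mat (outer (mean_error n \<omega>) (mean_error n \<omega>))) \<in> borel_measurable M"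
proof (rule borel_measurable_vec)
  fix p
  have "(\<lambda>\<omega>. mean_error n \<omega> $ j) \<in> borel_measurable M" for j
    by (rule borel_measurable_continuous_on[OF _ mean_error_measurable]) (intro continuous_intros)
  then show "(\<lambda>\<omega>. vec_mat (outer (mean_error n \<omega>) (mean_error n \<omega>)) $ p) \<in> borel_measurable M"
    unfolding vec_mat_def outer_def by simp
qed

lemma T_sq_measurable[measurable]: "(\<lambda>\<omega>. T_sq S0 n (\<lambda>k. Y k \<omega>)) \<in> borel_measurable M"
  unfolding T_sq_eq by measurable

end

section \<open>Asymptotics of the test statistic\<close>

context elliptical_iid
begin

lemma norm_error_term: "norm (sqrt (real n) *\<^sub>R vec_mat (outer (mean_error n \<omega>) (mean_error n \<omega>))) =
    sqrt (real n) * (mean_error n \<omega> \<bullet> mean_error n \<omega>)"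
  by (simp add: norm_vec_mat_outer)

lemma T_sq_nonneg: "0 \<le> T_sq S0 n y"
  by (simp add: T_sq_def)

text \<open>Under the null hypothesis the drift vanishes. The Laplace transform of the fluctuation
  alone converges, and the error \<open>E n\<close> changes it by at most a multiple of its expected
  norm, of order \<open>1 / sqrt n\<close>.\<close>

theorem Laplace_transform_T_sq_tendsto:
  fixes q :: "'d \<times> 'd \<Rightarrow> real^('d \<times> 'd)"
  assumes q: "\<And>a b. q a \<bullet> q b = (if a = b then 1 else 0)"
    and V: "\<And>a. limit_mat (kurtosis_param M (Y 1) \<mu> S i) S *v q a = d a *\<^sub>R q a"
    and d: "\<And>a. 0 \<le> d a"
  shows "(\<lambda>n. expectation (\<lambda>\<omega>. exp (- (real j * T_sq S n (\<lambda>k. Y k \<omega>))))) \<longlonglongrightarrow>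
    (\<Prod>a\<in>UNIV. \<integral>z. exp (- (real j * d a * z\<^sup>2)) \<partial>std_normal_distribution)"
proof -
  define U where "U n \<omega> = (1 / sqrt (real n)) *\<^sub>R W_sum n \<omega>" for n \<omega>
  define E where "E n \<omega> = sqrt (real n) *\<^sub>R vec_mat (outer (mean_error n \<omega>) (mean_error n \<omega>))" for n \<omega>
  have [measurable]: "U n \<in> borel_measurable M" "E n \<in> borel_measurable M" for n
    unfolding U_def[abs_def] E_def[abs_def] by measurable
  have T: "T_sq S n (\<lambda>k. Y k \<omega>) = (norm (U n \<omega> - E n \<omega>))\<^sup>2" for n \<omega>
    unfolding T_sq_eq U_def E_def by (simp add: vec_mat_def zero_vec_def[symmetric])
  have "(\<lambda>n. expectation (\<lambda>\<omega>. exp (- (real j * (U n \<omega> \<bullet> U n \<omega>))))) \<longlonglongrightarrow>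
    (\<Prod>a\<in>UNIV. \<integral>z. exp (- (real j * d a * z\<^sup>2)) \<partial>std_normal_distribution)"
    by (rule Laplace_transform_norm_tendsto[OF _ _ q V d])
      (use W_sum_char_tendsto in \<open>simp_all add: U_def[abs_def]\<close>)
  moreover have "(\<lambda>n. expectation (\<lambda>\<omega>. exp (- (real j * T_sq S n (\<lambda>k. Y k \<omega>)))) -
      expectation (\<lambda>\<omega>. exp (- (real j * (U n \<omega> \<bullet> U n \<omega>))))) \<longlonglongrightarrow> 0"
  proof (rule Lim_null_comparison)
    define C where "C = (\<Sum>j\<in>UNIV. S $ j $ j)"
    show "(\<lambda>n. sqrt (real j) * (sqrt (real n) * (C / real n))) \<longlonglongrightarrow> 0"
    proof -
      have "(\<lambda>n. sqrt (real j) * C * sqrt (1 / real n)) \<longlonglongrightarrow> sqrt (real j) * C * sqrt 0"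
        by (intro tendsto_intros lim_1_over_n)
      moreover have "sqrt (real n) * (C / real n) = C * sqrt (1 / real n)" for n
        by (cases "n = 0") (simp_all add: real_sqrt_divide field_simps)
      ultimately show ?thesis by (simp add: mult.assoc)
    qed
    show "\<forall>\<^sub>F n in sequentially. norm (expectation (\<lambda>\<omega>. exp (- (real j * T_sq S n (\<lambda>k. Y k \<omega>)))) -
      expectation (\<lambda>\<omega>. exp (- (real j * (U n \<omega> \<bullet> U n \<omega>))))) \<le> sqrt (real j) * (sqrt (real n) * (C / real n))"
      using eventually_gt_at_top[of 0]
    proof eventually_elim
      case (elim n)
      let ?r = "\<lambda>\<omega>. sqrt (real j) * (sqrt (real n) * (mean_error n \<omega> \<bullet> mean_error n \<omega>))"
      have int: "integrable M ?r" using expectation_mean_error(1) elim by simp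
      have "\<bar>exp (- (real j * T_sq S n (\<lambda>k. Y k \<omega>))) - exp (- (real j * (U n \<omega> \<bullet> U n \<omega>)))\<bar> \<le> ?r \<omega>" for \<omega>
      proof -
        have "\<bar>exp (- (sqrt (real j) * norm (U n \<omega> - E n \<omega>))\<^sup>2) - exp (- (sqrt (real j) * norm (U n \<omega>))\<^sup>2)\<bar>
            \<le> \<bar>sqrt (real j) * norm (U n \<omega> - E n \<omega>) - sqrt (real j) * norm (U n \<omega>)\<bar>"
          by (rule exp_minus_square_Lipschitz)
        also have "\<dots> = sqrt (real j) * \<bar>norm (U n \<omega> - E n \<omega>) - norm (U n \<omega>)\<bar>"
          by (simp add: right_diff_distrib[symmetric] abs_mult del: right_diff_distrib)
        also have "\<dots> \<le> sqrt (real j) * norm (E n \<omega>)"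
          using norm_triangle_ineq3[of "U n \<omega> - E n \<omega>" "U n \<omega>"] by (intro mult_left_mono) auto
        finally show ?thesis
          by (simp add: T power_mult_distrib power2_norm_eq_inner E_def norm_error_term del: norm_scaleR)
      qed
      moreover have "integrable M (\<lambda>\<omega>. exp (- (real j * T_sq S n (\<lambda>k. Y k \<omega>))))"
        "integrable M (\<lambda>\<omega>. exp (- (real j * (U n \<omega> \<bullet> U n \<omega>))))"
        by (rule integrable_const_bound[of _ 1], auto simp: T_sq_nonneg)+
      ultimately have "norm (expectation (\<lambda>\<omega>. exp (- (real j * T_sq S n (\<lambda>k. Y k \<omega>))) - exp (- (real j * (U n \<omega> \<bullet> U n \<omega>)))))
          \<le> expectation ?r"
        using int by (intro order_trans[OF integral_norm_bound] integral_mono) auto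
      moreover have "expectation ?r = sqrt (real j) * (sqrt (real n) * (C / real n))"
        using expectation_mean_error(2)[of n] elim by (simp add: C_def)
      ultimately show ?case
        using \<open>integrable M (\<lambda>\<omega>. exp (- (real j * T_sq S n (\<lambda>k. Y k \<omega>))))\<close>
          \<open>integrable M (\<lambda>\<omega>. exp (- (real j * (U n \<omega> \<bullet> U n \<omega>))))\<close> by simp
    qed
  qed
  ultimately show ?thesis using tendsto_add by fastforce
qed

theorem T_sq_weak_conv:
  assumes lam: "eigenvalue_list (limit_mat (kurtosis_param M (Y 1) \<mu> S i) S) m lam"
  shows "weak_conv_m (\<lambda>n. distr M borel (\<lambda>\<omega>. T_sq S n (\<lambda>k. Y k \<omega>))) (weighted_chisq m lam)"
    and "\<exists>k\<in>{1..m}. lam k \<noteq> 0"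
proof -
  define V where "V = limit_mat (kurtosis_param M (Y 1) \<mu> S i) S"
  obtain q :: "'d \<times> 'd \<Rightarrow> real^('d \<times> 'd)" and d where q: "\<And>a b. q a \<bullet> q b = (if a = b then 1 else 0)" and Vq: "\<And>a. V *v q a = d a *\<^sub>R q a"
    by (rule symmetric_matrix_eigenbasis[OF transpose_limit_mat[OF S, of "kurtosis_param M (Y 1) \<mu> S i", folded V_def]]) blast
  \<comment> \<open>Each eigenvalue is the variance of the projection of \<open>obs.W\<close> onto
    its unit eigenvector.\<close>
  have d: "0 \<le> d a" for a
  proof -
    have "0 \<le> expectation (\<lambda>\<omega>. (q a \<bullet> obs.W \<omega>)\<^sup>2)" by (rule integral_nonneg_AE) simp
    also have "\<dots> = q a \<bullet> (V *v q a)"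
      by (simp add: obs.expectation_inner_W_power2[of _ i] V_def)
    finally show ?thesis by (simp add: Vq q)
  qed
  have mset: "image_mset lam (mset_set {1..m}) = image_mset d (mset_set UNIV)"
    by (rule image_mset_eigenvalue_list[OF q Vq lam[folded V_def]])
  have "set_mset (image_mset lam (mset_set {1..m})) = set_mset (image_mset d (mset_set UNIV))"
    by (simp only: mset)
  then have range: "lam ` {1..m} = range d" by simp
  have lam0: "0 \<le> lam k" if "k \<in> {1..m}" for k
    using that range d by (metis imageI rangeE)
  have prod: "(\<Prod>k\<in>{1..m}. h (lam k)) = (\<Prod>a\<in>UNIV. h (d a))" for h :: "real \<Rightarrow> real"
  proof -
    have "(\<Prod>k\<in>{1..m}. h (lam k)) = prod_mset (image_mset h (image_mset lam (mset_set {1..m})))"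
      by (simp add: prod_unfold_prod_mset multiset.map_comp comp_def)
    also have "\<dots> = (\<Prod>a\<in>UNIV. h (d a))"
      unfolding mset by (simp add: prod_unfold_prod_mset multiset.map_comp comp_def)
    finally show ?thesis .
  qed
  \<comment> \<open>If all eigenvalues were zero, \<open>V\<close> would vanish on an orthonormal
    basis, and by symmetry and Parseval's identity everywhere, contradicting its positive diagonal
    entry at \<open>(i, i)\<close>.\<close>
  show "\<exists>k\<in>{1..m}. lam k \<noteq> 0"
  proof (rule ccontr)
    assume "\<not> ?thesis"
    then have "d a = 0" for a using range by (metis imageE rangeI)
    then have "V *v q a = 0" for a by (simp add: Vq)
    define e where "e = axis (i, i) (1::real)"
    have "(V *v e) \<bullet> (V *v e) = (\<Sum>a\<in>UNIV. (q a \<bullet> (V *v e))\<^sup>2)"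
      by (rule orthonormal_family_Parseval[OF q, symmetric])
    also have "\<dots> = 0"
    proof (rule sum.neutral, rule ballI)
      fix a
      have "q a \<bullet> (V *v e) = (V *v q a) \<bullet> e"
        by (metis V_def S dot_lmul_matrix transpose_limit_mat transpose_matrix_vector)
      then show "(q a \<bullet> (V *v e))\<^sup>2 = 0" by (simp add: \<open>V *v q a = 0\<close>)
    qed
    finally have "V *v e = 0" by simp
    then have "V $ (i, i) $ (i, i) = 0"
      by (simp add: e_def matrix_vector_mult_basis column_def vec_eq_iff)
    then show False using obs.limit_mat_diag_pos[of i i] by (simp add: V_def)
  qed
  show "weak_conv_m (\<lambda>n. distr M borel (\<lambda>\<omega>. T_sq S n (\<lambda>k. Y k \<omega>))) (weighted_chisq m lam)"
  proof (rule Laplace_transform_tendsto_imp_weak_conv)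
    show "real_distribution (distr M borel (\<lambda>\<omega>. T_sq S n (\<lambda>k. Y k \<omega>)))" for n
      by (rule real_distribution_distr) measurable
    show "AE x in distr M borel (\<lambda>\<omega>. T_sq S n (\<lambda>k. Y k \<omega>)). 0 \<le> x" for n
      by (subst AE_distr_iff) (auto simp: T_sq_nonneg)
    show "AE x in weighted_chisq m lam. 0 \<le> x" by (rule AE_weighted_chisq_nonneg[OF lam0])
    show "(\<lambda>n. \<integral>x. exp (- (real j * x)) \<partial>distr M borel (\<lambda>\<omega>. T_sq S n (\<lambda>k. Y k \<omega>)))
        \<longlonglongrightarrow> (\<integral>x. exp (- (real j * x)) \<partial>weighted_chisq m lam)" for j :: nat
    proof -
      have "(\<integral>x. exp (- (real j * x)) \<partial>weighted_chisq m lam) =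
          (\<Prod>a\<in>UNIV. \<integral>z. exp (- (real j * d a * z\<^sup>2)) \<partial>std_normal_distribution)"
        by (rule trans[OF Laplace_transform_weighted_chisq[OF lam0 of_nat_0_le_iff]], assumption)
          (rule prod[of "\<lambda>t. \<integral>z. exp (- (real j * t * z\<^sup>2)) \<partial>std_normal_distribution"])
      then show ?thesis
        using Laplace_transform_T_sq_tendsto[OF q Vq[unfolded V_def] d, of j] by (simp add: integral_distr)
    qed
  qed (rule real_distribution_weighted_chisq)
qed

text \<open>The limit law has no atoms, so its distribution function equals
  \<open>1 - \<alpha>\<close> at the quantile and is continuous there; weak convergence can be read
  off at this point.\<close>

theorem T_sq_size:
  assumes "eigenvalue_list (limit_mat (kurtosis_param M (Y 1) \<mu> S i) S) m lam"
    and "0 < \<alpha>" "\<alpha> < 1" and c: "c = quantile (weighted_chisq m lam) (1 - \<alpha>)"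
  shows "(\<lambda>n. prob {\<omega> \<in> space M. T_sq S n (\<lambda>k. Y k \<omega>) > c}) \<longlonglongrightarrow> \<alpha>"
proof -
  let ?D = "weighted_chisq m lam"
  interpret D: real_distribution ?D by (rule real_distribution_weighted_chisq)
  note conv = T_sq_weak_conv[OF assms(1)]
  have nonatomic: "measure ?D {x} = 0" for x using conv(2) measure_weighted_chisq_singleton by blast
  have "cdf ?D c = 1 - \<alpha>"
    unfolding c using assms(2,3) by (intro cdf_quantile real_distribution_weighted_chisq nonatomic) auto
  moreover have "isCont (cdf ?D) c" by (simp add: D.isCont_cdf nonatomic)
  ultimately have "(\<lambda>n. cdf (distr M borel (\<lambda>\<omega>. T_sq S n (\<lambda>k. Y k \<omega>))) c) \<longlonglongrightarrow> 1 - \<alpha>"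
    using conv(1) unfolding weak_conv_m_def weak_conv_def by metis
  then have "(\<lambda>n. 1 - cdf (distr M borel (\<lambda>\<omega>. T_sq S n (\<lambda>k. Y k \<omega>))) c) \<longlonglongrightarrow> 1 - (1 - \<alpha>)"
    by (intro tendsto_intros)
  moreover have "1 - cdf (distr M borel (\<lambda>\<omega>. T_sq S n (\<lambda>k. Y k \<omega>))) c = prob {\<omega> \<in> space M. T_sq S n (\<lambda>k. Y k \<omega>) > c}" for n
  proof -
    have "cdf (distr M borel (\<lambda>\<omega>. T_sq S n (\<lambda>k. Y k \<omega>))) c = prob {\<omega> \<in> space M. T_sq S n (\<lambda>k. Y k \<omega>) \<le> c}"
      unfolding cdf_def by (subst measure_distr) (auto intro!: arg_cong[where f=prob])
    also have "\<dots> = 1 - prob {\<omega> \<in> space M. \<not> T_sq S n (\<lambda>k. Y k \<omega>) \<le> c}"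
      by (subst prob_neg) auto
    finally show ?thesis by (simp add: not_le)
  qed
  ultimately show ?thesis by simp
qed

text \<open>For fixed \<open>c\<close> the event \<open>T_sq \<le> c\<close> eventually confines the
  estimation error so that it must offset a drift of fixed size \<open>\<delta>\<close>. The
  probability of such a deviation is \<open>O(1 / n)\<close>.\<close>

theorem T_sq_consistency:
  assumes "S \<noteq> S0"
  shows "(\<lambda>n. prob {\<omega> \<in> space M. T_sq S0 n (\<lambda>k. Y k \<omega>) > c}) \<longlonglongrightarrow> 1"
proof -
  define \<delta> where "\<delta> = norm (vec_mat (S - S0))"
  have "vec_mat (S - S0) \<noteq> 0" using assms by (auto simp: vec_mat_def vec_eq_iff)
  then have "0 < \<delta>" by (simp add: \<delta>_def)
  obtain C where C: "\<And>n. integrable M (\<lambda>\<omega>. W_sum n \<omega> \<bullet> W_sum n \<omega>)"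
    "\<And>n. expectation (\<lambda>\<omega>. W_sum n \<omega> \<bullet> W_sum n \<omega>) = real n * C"
    by (rule expectation_W_sum) blast
  define C' where "C' = (\<Sum>j\<in>UNIV. S $ j $ j)"
  \<comment> \<open>The coefficients come from the threshold \<open>\<delta> / 4\<close>:
    Chebyshev's inequality for the fluctuation gives \<open>16 / \<delta>^2\<close>, and Markov's
    inequality for the rank-one error gives \<open>4 / \<delta>\<close>.\<close>
  define b where "b n = (16 / \<delta>\<^sup>2 * C + 4 / \<delta> * C') / real n" for n
  have bound: "prob {\<omega> \<in> space M. T_sq S0 n (\<lambda>k. Y k \<omega>) \<le> c} \<le> b n" if n: "n \<noteq> 0" "c / real n < (\<delta> / 2)\<^sup>2" for n
  proof -
    let ?R = "\<lambda>\<omega>. mean_error n \<omega> \<bullet> mean_error n \<omega>"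
    let ?A = "\<lambda>\<omega>. (1 / real n)\<^sup>2 * (W_sum n \<omega> \<bullet> W_sum n \<omega>)"
    let ?f = "\<lambda>\<omega>. 16 / \<delta>\<^sup>2 * ?A \<omega> + 4 / \<delta> * ?R \<omega>"
    have int: "integrable M ?f" using C(1) expectation_mean_error(1)[OF n(1)] by simp
    have "1 \<le> ?f \<omega>" if "T_sq S0 n (\<lambda>k. Y k \<omega>) \<le> c" for \<omega>
    proof -
      let ?a = "(1 / real n) *\<^sub>R W_sum n \<omega>" and ?r = "vec_mat (outer (mean_error n \<omega>) (mean_error n \<omega>))"
      have "T_sq S0 n (\<lambda>k. Y k \<omega>) = real n * (norm (?a + vec_mat (S - S0) - ?r))\<^sup>2"
        unfolding T_sq_def vec_mat_sample_cov[OF n(1), of _ S0 \<mu> S] mean_error_def W_sum_def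
        by (simp add: power_mult_distrib)
      then have "(norm (?a + vec_mat (S - S0) - ?r))\<^sup>2 \<le> c / real n"
        using that n(1) by (simp add: field_simps)
      then have "(norm (?a + vec_mat (S - S0) - ?r))\<^sup>2 < (\<delta> / 2)\<^sup>2" using n(2) by linarith
      then have "norm (?a + vec_mat (S - S0) - ?r) < \<delta> / 2"
        by (rule power_less_imp_less_base) (use \<open>0 < \<delta>\<close> in simp)
      moreover have "\<delta> \<le> norm (?a + vec_mat (S - S0) - ?r) + norm ?a + norm ?r"
      proof -
        have "vec_mat (S - S0) = (?a + vec_mat (S - S0) - ?r) - ?a + ?r" by simp
        then have "\<delta> \<le> norm ((?a + vec_mat (S - S0) - ?r) - ?a) + norm ?r"
          unfolding \<delta>_def by (metis norm_triangle_ineq)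
        also have "norm ((?a + vec_mat (S - S0) - ?r) - ?a) \<le> norm (?a + vec_mat (S - S0) - ?r) + norm ?a"
          by (rule norm_triangle_ineq4)
        finally show ?thesis by simp
      qed
      \<comment> \<open>The total is below \<open>\<delta> / 2\<close>, so the other two norms sum
        to more than \<open>\<delta> / 2\<close> and one of them is at least half of that.\<close>
      ultimately have cases: "\<delta> / 4 \<le> norm ?a \<or> \<delta> / 4 \<le> norm ?r" by linarith
      have A: "?A \<omega> = (norm ?a)\<^sup>2" by (simp add: dot_square_norm power_divide)
      have R: "?R \<omega> = norm ?r" by (simp add: norm_vec_mat_outer)
      have nonneg: "0 \<le> 16 / \<delta>\<^sup>2 * (norm ?a)\<^sup>2" "0 \<le> 4 / \<delta> * norm ?r" using \<open>0 < \<delta>\<close> by auto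
      have "1 \<le> 16 / \<delta>\<^sup>2 * t\<^sup>2" "1 \<le> 4 / \<delta> * t" if "\<delta> / 4 \<le> t" for t
      proof -
        have "(\<delta> / 4)\<^sup>2 \<le> t\<^sup>2" using that \<open>0 < \<delta>\<close> by (intro power_mono) auto
        then show "1 \<le> 16 / \<delta>\<^sup>2 * t\<^sup>2" "1 \<le> 4 / \<delta> * t"
          using \<open>0 < \<delta>\<close> that by (simp_all add: power_divide field_simps)
      qed
      from this[of "norm ?a"] this[of "norm ?r"] show ?thesis unfolding A R using cases nonneg by linarith
    qed
    then have "indicator {\<omega> \<in> space M. T_sq S0 n (\<lambda>k. Y k \<omega>) \<le> c} \<omega> \<le> ?f \<omega>" for \<omega>
      using \<open>0 < \<delta>\<close> by (auto simp: indicator_def)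
    then have "expectation (indicator {\<omega> \<in> space M. T_sq S0 n (\<lambda>k. Y k \<omega>) \<le> c}) \<le> expectation ?f"
      using int by (intro integral_mono integrable_real_indicator) (auto simp: less_top[symmetric])
    also have "expectation ?f = 16 / \<delta>\<^sup>2 * ((1 / real n)\<^sup>2 * (real n * C)) + 4 / \<delta> * (C' / real n)"
      using C expectation_mean_error[OF n(1)] by (simp add: C'_def)
    also have "\<dots> = b n"
      using n(1) by (simp add: b_def add_divide_distrib power2_eq_square)
    finally show ?thesis by simp
  qed
  have compl: "prob {\<omega> \<in> space M. T_sq S0 n (\<lambda>k. Y k \<omega>) > c} = 1 - prob {\<omega> \<in> space M. T_sq S0 n (\<lambda>k. Y k \<omega>) \<le> c}" for n
    by (subst prob_neg[symmetric]) (auto simp: not_le)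
  have "(\<lambda>n. c / real n) \<longlonglongrightarrow> 0" by (rule lim_const_over_n)
  then have "\<forall>\<^sub>F n in sequentially. c / real n < (\<delta> / 2)\<^sup>2"
    by (rule order_tendstoD) (use \<open>0 < \<delta>\<close> in simp)
  then have lower: "\<forall>\<^sub>F n in sequentially. 1 - b n \<le> prob {\<omega> \<in> space M. T_sq S0 n (\<lambda>k. Y k \<omega>) > c}"
    using eventually_gt_at_top[of 0] by eventually_elim (use bound compl in force)
  have "b \<longlonglongrightarrow> 0" unfolding b_def by (rule lim_const_over_n)
  then have "(\<lambda>n. 1 - b n) \<longlonglongrightarrow> 1 - 0" by (intro tendsto_intros)
  then show ?thesis
    by (intro tendsto_sandwich[OF lower always_eventually[OF allI[OF prob_le_1]] _ tendsto_const]) simp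
qed

end

theorem proposition2p1:
  fixes M :: "'a measure" and Y :: "nat \<Rightarrow> 'a \<Rightarrow> real^'d"
    and \<mu> :: "real^'d" and S S0 :: "real^'d^'d" and g :: "real \<Rightarrow> real"
    and \<kappa> \<alpha> c :: real and i :: 'd and lam :: "nat \<Rightarrow> real"
  assumes "prob_space M"
    and "density_generator CARD('d) g"
    and "pos_def S" and "pos_def S0"
    and "elliptical_sample M Y \<mu> S g"
    and "\<forall>j. integrable M (\<lambda>\<omega>. (Y 1 \<omega> $ j - \<mu> $ j) ^ 4)"
    and "covariance_mat M (Y 1) \<mu> = S"
    and "\<kappa> = kurtosis_param M (Y 1) \<mu> S i"
    and "0 < \<alpha>" and "\<alpha> < 1"
    and "eigenvalue_list (limit_mat \<kappa> S0) (CARD('d)\<^sup>2) lam"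
    and "c = quantile (weighted_chisq (CARD('d)\<^sup>2) lam) (1 - \<alpha>)"
  shows "(S = S0 \<longrightarrow>
           (\<lambda>n. measure M {\<omega> \<in> space M. T_sq S0 n (\<lambda>k. Y k \<omega>) > c}) \<longlonglongrightarrow> \<alpha>) \<and>
         (S \<noteq> S0 \<longrightarrow>
           (\<lambda>n. measure M {\<omega> \<in> space M. T_sq S0 n (\<lambda>k. Y k \<omega>) > c}) \<longlonglongrightarrow> 1)"
proof -
  interpret elliptical_iid M Y \<mu> S g
    using assms(1,3,5,6,7) by (simp add: elliptical_iid_def elliptical_iid_axioms_def)
  show ?thesis
    \<comment> \<open>When \<open>S = S0\<close> the given eigenvalues are those of the limit matrix
      at \<open>S\<close>; consistency holds at any fixed critical value.\<close>
    using T_sq_size[of i "CARD('d)\<^sup>2" lam \<alpha> c] T_sq_consistency[of S0 c] assms(8-12) by auto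
qed

end
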